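(* Let $\lambda\in\mathbb{R}$, $\delta>0$, $\alpha>|\beta|\geq 0$, and set $\nu=\lambda-1/2$. Let $h:\mathbb{R}\rightarrow\mathbb{R}$ be measurable and let $\tilde{h}(x)=h(x)-\mathrm{GH}_{\delta,0}^{\lambda,\alpha,\beta}h$. Then the function $f:\mathbb{R}\rightarrow\mathbb{R}$, as given by \begin{align*}f(x)&=-\frac{\mathrm{e}^{-\beta x}K_{\nu}(\alpha\sqrt{\delta^2+x^2})}{(\delta^2+x^2)^{\nu/2}}\int_0^x \mathrm{e}^{\beta t}(\delta^2+t^2)^{\nu/2}I_{\nu}(\alpha\sqrt{t^2+\delta^2})\tilde{h}(t)\,\mathrm{d}t \\ &\quad-\frac{\mathrm{e}^{-\beta x}I_{\nu}(\alpha\sqrt{\delta^2+x^2})}{(\delta^2+x^2)^{\nu/2}}\int_x^{\infty} \mathrm{e}^{\beta t}(\delta^2+t^2)^{\nu/2}K_{\nu}(\alpha\sqrt{t^2+\delta^2})\tilde{h}(t)\,\mathrm{d}t \\ &=-\frac{\mathrm{e}^{-\beta x}K_{\nu}(\alpha\sqrt{\delta^2+x^2})}{(\delta^2+x^2)^{\nu/2}}\int_0^x \mathrm{e}^{\beta t}(\delta^2+t^2)^{\nu/2}I_{\nu}(\alpha\sqrt{t^2+\delta^2})\tilde{h}(t)\,\mathrm{d}t \\ &\quad+\frac{\mathrm{e}^{-\beta x}I_{\nu}(\alpha\sqrt{\delta^2+x^2})}{(\delta^2+x^2)^{\nu/2}}\int_{-\infty}^x \mathrm{e}^{\beta t}(\delta^2+t^2)^{\nu/2}K_{\nu}(\alpha\sqrt{t^2+\delta^2})\tilde{h}(t)\,\mathrm{d}t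 \end{align*} (the two expressions being equal), solves the $GH(\lambda,\alpha,\beta,\delta,0)$ Stein equation $$\frac{x^2+\delta^2}{x}f''(x)+\bigg[2\lambda+2\beta x+\frac{2\beta\delta^2}{x}-\frac{\delta^2}{x^2}\bigg]f'(x)+\bigg[2\lambda\beta-(\alpha^2-\beta^2)x+\frac{\beta^2\delta^2}{x}-\frac{\beta\delta^2}{x^2}\bigg]f(x)=h(x)-\mathrm{GH}_{\delta,0}^{\lambda,\alpha,\beta}h.$$
   Context: Modified Bessel functions: for $\nu\in\mathbb{R}$, $I_{\nu}(x)=\sum_{k=0}^{\infty}\frac{1}{\Gamma(\nu+k+1)k!}\left(\frac{x}{2}\right)^{\nu+2k}$ (first kind), and $K_\nu(x)=\int_0^\infty \mathrm{e}^{-x\cosh(t)}\cosh(\nu t)\,\mathrm{d}t$ for $x>0$ (second kind). For $\lambda\in\mathbb{R}$, $\delta>0$, $\alpha>|\beta|\geq0$, the generalized hyperbolic distribution $GH(\lambda,\alpha,\beta,\delta,0)$ is the probability distribution on $\mathbb{R}$ with density $$p(x)=\frac{(\alpha^2 - \beta^2)^{\lambda/2}}{\sqrt{2\pi}\, \alpha^{\lambda -\frac{1}{2}}\delta^{\lambda}K_{\lambda}(\delta\sqrt{\alpha^2-\beta^2})}\,\mathrm{e}^{\beta x}(\delta^2+x^2)^{(\lambda-\frac{1}{2})/2}K_{\lambda-\frac{1}{2}}(\alpha\sqrt{\delta^2+x^2}),\quad x\in\mathbb{R}.$$ $\mathrm{GH}_{\delta,0}^{\lambda,\alpha,\beta}h$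 denotes $\mathbb{E}h(X)$ for $X\sim GH(\lambda,\alpha,\beta,\delta,0)$.
   Formalization: h is assumed GH-integrable so that GH h exists; as f'' fails to exist at jumps of h (e.g. h=1_{(1,∞)}), "solves" means f' locally absolutely continuous, the equation holding a.e. and at every x≠0 where h is continuous. *)

theory Defs
  imports "HOL-Analysis.Analysis"
begin

text \<open>
  Both Bessel functions are only used at positive arguments. The function \<open>rGamma\<close> is the total
  reciprocal Gamma function, which vanishes at the poles of \<open>Gamma\<close>; this is the usual
  convention for \<open>1 / Gamma\<close> when the order is a negative integer.
\<close>

definition bessel_I :: "real \<Rightarrow> real \<Rightarrow> real" where
  "bessel_I \<nu> x =
     (\<Sum>k. rGamma (\<nu> + real k + 1) / fact k * (x / 2) powr (\<nu> + 2 * real k))"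

definition bessel_K :: "real \<Rightarrow> real \<Rightarrow> real" where
  "bessel_K \<nu> x = (LBINT t:{0..}. exp (- x * cosh t) * cosh (\<nu> * t))"

definition gh_density :: "real \<Rightarrow> real \<Rightarrow> real \<Rightarrow> real \<Rightarrow> real \<Rightarrow> real" where
  "gh_density l \<alpha> \<beta> \<delta> x =
     (\<alpha>\<^sup>2 - \<beta>\<^sup>2) powr (l / 2) /
       (sqrt (2 * pi) * \<alpha> powr (l - 1 / 2) * \<delta> powr l * bessel_K l (\<delta> * sqrt (\<alpha>\<^sup>2 - \<beta>\<^sup>2)))
     * exp (\<beta> * x) * (\<delta>\<^sup>2 + x\<^sup>2) powr ((l - 1 / 2) / 2)
     * bessel_K (l - 1 / 2) (\<alpha> * sqrt (\<delta>\<^sup>2 + x\<^sup>2))"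

text \<open>
  The generalized hyperbolic distribution with location parameter \<open>0\<close>; the argument \<open>l\<close> is the
  parameter commonly written as lambda.
\<close>

definition gh_distribution :: "real \<Rightarrow> real \<Rightarrow> real \<Rightarrow> real \<Rightarrow> real measure" where
  "gh_distribution l \<alpha> \<beta> \<delta> = density lborel (\<lambda>x. ennreal (gh_density l \<alpha> \<beta> \<delta> x))"

definition gh_expectation ::
  "real \<Rightarrow> real \<Rightarrow> real \<Rightarrow> real \<Rightarrow> (real \<Rightarrow> real) \<Rightarrow> real" where
  "gh_expectation l \<alpha> \<beta> \<delta> h = (\<integral>x. h x \<partial>gh_distribution l \<alpha> \<beta> \<delta>)"

text \<open>
  The left-hand side of the Stein equation. It is singular at \<open>x = 0\<close> and is only meaningful for
  \<open>x \<noteq> 0\<close> at which \<open>f\<close> is twice differentiable.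
\<close>

definition gh_stein_operator ::
  "real \<Rightarrow> real \<Rightarrow> real \<Rightarrow> real \<Rightarrow> (real \<Rightarrow> real) \<Rightarrow> real \<Rightarrow> real" where
  "gh_stein_operator l \<alpha> \<beta> \<delta> f x =
     (x\<^sup>2 + \<delta>\<^sup>2) / x * deriv (deriv f) x
     + (2 * l + 2 * \<beta> * x + 2 * \<beta> * \<delta>\<^sup>2 / x - \<delta>\<^sup>2 / x\<^sup>2) * deriv f x
     + (2 * l * \<beta> - (\<alpha>\<^sup>2 - \<beta>\<^sup>2) * x + \<beta>\<^sup>2 * \<delta>\<^sup>2 / x - \<beta> * \<delta>\<^sup>2 / x\<^sup>2) * f x"

text \<open>
  Solutions of the Stein equation with right-hand side \<open>h - E h(X)\<close>. For merely measurable \<open>h\<close> a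
  solution cannot be expected to be twice differentiable everywhere, so the usual (Caratheodory)
  notion is used: \<open>f\<close> is differentiable, its derivative is a locally absolutely continuous function
  (the integral of its almost everywhere derivative), and the equation holds almost everywhere.
  Moreover the equation is required to hold in the classical sense at every
  \<open>x \<noteq> 0\<close> at which \<open>h\<close> is continuous; for continuous \<open>h\<close> this is every \<open>x \<noteq> 0\<close>.
\<close>

definition solves_gh_stein_equation ::
  "real \<Rightarrow> real \<Rightarrow> real \<Rightarrow> real \<Rightarrow> (real \<Rightarrow> real) \<Rightarrow> (real \<Rightarrow> real) \<Rightarrow> bool" where
  "solves_gh_stein_equation l \<alpha> \<beta> \<delta> h f \<longleftrightarrow>
     (\<forall>x. f differentiable (at x)) \<and>
     (\<forall>a b. a \<le> b \<longrightarrow> deriv (deriv f) absolutely_integrable_on {a..b} \<and>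
        (deriv (deriv f) has_integral (deriv f b - deriv f a)) {a..b}) \<and>
     (AE x in lborel. deriv f differentiable (at x) \<and>
        gh_stein_operator l \<alpha> \<beta> \<delta> f x = h x - gh_expectation l \<alpha> \<beta> \<delta> h) \<and>
     (\<forall>x. x \<noteq> 0 \<and> isCont h x \<longrightarrow> deriv f differentiable (at x) \<and>
        gh_stein_operator l \<alpha> \<beta> \<delta> f x = h x - gh_expectation l \<alpha> \<beta> \<delta> h)"

end

theory Submission
  imports Defs "HOL-Probability.Distributions" "HOL-Real_Asymp.Real_Asymp"
begin

text \<open>
  Put \<open>\<nu> = l - 1/2\<close> and \<open>z = \<alpha>\<^sup>2 * (\<delta>\<^sup>2 + x\<^sup>2) / 4\<close>. Writing a function as \<open>exp (- \<beta> * x) * y z\<close> turns the homogeneous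
  Stein equation into \<open>z * y'' + (\<nu> + 1) * y' = y\<close>, the modified Bessel equation in disguise. Its solutions are the
  power series \<open>bessel_series \<nu>\<close>, which is \<open>I\<^sub>\<nu>\<close> without its algebraic factor, and the integral of
  \<open>v powr (- \<nu> - 1) * exp (- v - z / v)\<close> over \<open>v > 0\<close>, which is the corresponding form of \<open>K\<^sub>\<nu>\<close>. Because \<open>z\<close> is a
  positive polynomial in \<open>x\<close>, the resulting fundamental solutions \<open>A\<close> (from \<open>K\<^sub>\<nu>\<close>) and \<open>B\<close> (from \<open>I\<^sub>\<nu>\<close>) are smooth on
  the whole line, and the apparent singularity of the equation at \<open>x = 0\<close> never enters.

  The function in question is what variation of constants produces from \<open>A\<close> and \<open>B\<close>. That it works with the stated
  constants is the Wronskian identity \<open>I\<^sub>\<nu>(x) * K\<^bsub>\<nu>+1\<^esub>(x) + I\<^bsub>\<nu>+1\<^esub>(x) * K\<^sub>\<nu>(x) = 1 / x\<close> (\<open>wronskian_form_eq_1\<close>). It is proved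
  for all real orders by noting that it is constant in the argument and invariant under a shift of the order, which reduces
  it to the limit at zero for large order.

  Integrability at infinity and the equality of the two formulas both come from the weight
  \<open>exp (\<beta> * t) * (\<delta>\<^sup>2 + t\<^sup>2) powr (\<nu> / 2) * K\<^sub>\<nu>(\<alpha> * sqrt (t\<^sup>2 + \<delta>\<^sup>2))\<close> being a multiple of the density: against it, \<open>h - E h(X)\<close> has
  integral zero, provided that the density really has mass one. The latter (\<open>gh_density_total_mass\<close>) holds because the
  law is a Gaussian mixture over a generalized inverse Gaussian variable, whose mass is again a value of \<open>K\<close>
  (\<open>gig_integral_eq_bessel_K\<close>).

  For merely measurable \<open>h\<close> the two integrals in \<open>f\<close> are only absolutely continuous in \<open>x\<close>. The substitute for the product rule is
  \<open>product_primitive\<close>. Used once, it shows that \<open>f\<close> has everywhere the derivative that formal differentiation predicts; used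
  again, that this derivative is the primitive of a locally integrable function. Lebesgue's differentiation theorem then gives the
  second derivative almost everywhere, and continuity of \<open>h\<close> at a point gives it there.
\<close>

section \<open>Primitives of locally integrable functions\<close>

definition locally_integrable :: "(real \<Rightarrow> real) \<Rightarrow> bool" where
  "locally_integrable p \<longleftrightarrow> (\<forall>a b. set_integrable lborel {a..b} p)"

lemma locally_integrable_interval:
  assumes "locally_integrable p"
  shows "interval_lebesgue_integrable lborel (ereal a) (ereal b) p"
proof -
  have "set_integrable lborel {a..b} p" "set_integrable lborel {b..a} p"
    using assms by (auto simp: locally_integrable_def)
  then show ?thesis
    unfolding interval_lebesgue_integrable_def
    by (auto intro: set_integrable_subset[of _ "{a..b}"] set_integrable_subset[of _ "{b..a}"])
qed

lemma locally_integrable_interval_sum: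
  assumes "locally_integrable p"
  shows "(LBINT t=ereal a..ereal b. p t) + (LBINT t=ereal b..ereal c. p t) = (LBINT t=ereal a..ereal c. p t)"
  using locally_integrable_interval[OF assms]
  by (intro interval_integral_sum) (simp flip: ereal_min ereal_max)

lemma locally_integrable_mult_continuous:
  assumes u: "continuous_on UNIV u" and p: "locally_integrable p"
  shows "locally_integrable (\<lambda>x. u x * p x)"
  unfolding locally_integrable_def
proof (intro allI)
  fix a b :: real
  have "compact (u ` {a..b})"
    using u by (intro compact_continuous_image) (auto intro: continuous_on_subset)
  then obtain C where "\<forall>y\<in>u ` {a..b}. norm y \<le> C"
    using compact_imp_bounded bounded_iff by blast
  then have C: "\<bar>u x\<bar> \<le> C" if "x \<in> {a..b}" for x
    using that by auto
  have [measurable]: "u \<in> borel_measurable borel"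
    using u by (rule borel_measurable_continuous_onI)
  have i: "integrable lborel (\<lambda>x. indicator {a..b} x *\<^sub>R p x)"
    using p by (auto simp: locally_integrable_def set_integrable_def)
  then have [measurable]: "(\<lambda>x. indicator {a..b} x *\<^sub>R p x) \<in> borel_measurable borel"
    by auto
  have m: "(\<lambda>x. u x * (indicator {a..b} x *\<^sub>R p x)) \<in> borel_measurable lborel"
    by measurable
  have "integrable lborel (\<lambda>x. u x * (indicator {a..b} x *\<^sub>R p x))"
  proof (rule Bochner_Integration.integrable_bound)
    show "integrable lborel (\<lambda>x. C * (indicator {a..b} x *\<^sub>R p x))"
      using i by (intro integrable_mult_right)
    show "AE x in lborel. norm (u x * (indicat_real {a..b} x *\<^sub>R p x))
            \<le> norm (C * (indicat_real {a..b} x *\<^sub>R p x))"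
    proof (intro AE_I2)
      fix x
      show "norm (u x * (indicat_real {a..b} x *\<^sub>R p x)) \<le> norm (C * (indicat_real {a..b} x *\<^sub>R p x))"
        using C[of x] by (cases "x \<in> {a..b}") (auto simp: abs_mult intro!: mult_right_mono)
    qed
  qed (rule m)
  then show "set_integrable lborel {a..b} (\<lambda>x. u x * p x)"
    unfolding set_integrable_def by (simp add: mult_ac)
qed

lemma locally_integrable_continuous:
  "continuous_on UNIV u \<Longrightarrow> locally_integrable u"
  unfolding locally_integrable_def
  by (auto intro!: borel_integrable_atLeastAtMost' intro: continuous_on_subset)

lemma locally_integrable_add:
  "locally_integrable p \<Longrightarrow> locally_integrable q \<Longrightarrow> locally_integrable (\<lambda>x. p x + q x)"
  unfolding locally_integrable_def by (auto intro: set_integral_add)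

lemma locally_integrable_abs:
  "locally_integrable p \<Longrightarrow> locally_integrable (\<lambda>x. \<bar>p x\<bar>)"
  unfolding locally_integrable_def by (auto intro: set_integrable_abs)

lemma locally_integrable_integrable_on:
  "locally_integrable p \<Longrightarrow> p integrable_on {a..b}"
  unfolding locally_integrable_def by (auto intro: set_borel_integral_eq_integral)

text \<open>
Interval integrals carry a sign and so describe a primitive on both sides of its base point, whereas
the Henstock-Kurzweil theory of indefinite integrals is one-sided. Moving the base point to the left
of the region of interest transfers continuity and differentiability from one to the other.
\<close>

lemma primitive_eq_integral:
  assumes "locally_integrable p" "a \<le> x"
  shows "(LBINT t=ereal c..ereal x. p t) = (LBINT t=ereal c..ereal a. p t) + integral {a..x} p"
proof -
  have "(LBINT t=ereal a..ereal x. p t) = integral {a..x} p"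
    using assms by (intro interval_integral_eq_integral) (auto simp: locally_integrable_def)
  then show ?thesis
    using locally_integrable_interval_sum[OF assms(1), of c a x] by simp
qed

lemma primitive_continuous:
  assumes p: "locally_integrable p"
  shows "isCont (\<lambda>x. LBINT t=ereal c..ereal x. p t) x"
proof -
  have "continuous_on {x-1..x+1} (\<lambda>y. (LBINT t=ereal c..ereal (x-1). p t) + integral {x-1..y} p)"
    by (intro continuous_intros indefinite_integral_continuous_1 locally_integrable_integrable_on p)
  then have "continuous_on {x-1..x+1} (\<lambda>y. LBINT t=ereal c..ereal y. p t)"
    by (rule continuous_on_eq) (auto intro!: primitive_eq_integral[OF p, symmetric])
  then show ?thesis
    by (rule continuous_on_interior) auto
qed

lemma primitive_has_derivative_isCont:
  assumes p: "locally_integrable p" and x: "isCont p x"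
  shows "((\<lambda>x. LBINT t=ereal c..ereal x. p t) has_real_derivative p x) (at x)"
proof -
  have "((\<lambda>y. integral {x-1..y} p) has_vector_derivative p x) (at x within ({x-1..x+1} - {}))"
    by (rule integral_has_vector_derivative_continuous_at)
       (auto intro: locally_integrable_integrable_on p continuous_at_imp_continuous_at_within x)
  then have "((\<lambda>y. integral {x-1..y} p) has_real_derivative p x) (at x within {x-1..x+1})"
    by (simp add: has_real_derivative_iff_has_vector_derivative)
  then have "((\<lambda>y. integral {x-1..y} p) has_real_derivative p x) (at x)"
    by (subst (asm) at_within_interior) auto
  then have "((\<lambda>y. (LBINT t=ereal c..ereal (x-1). p t) + integral {x-1..y} p) has_real_derivative p x) (at x)"
    by (auto intro!: derivative_eq_intros)
  then show ?thesis
    by (rule has_field_derivative_transform_within[where d=1])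
       (auto simp: dist_real_def intro!: primitive_eq_integral[OF p, symmetric])
qed

text \<open>
Lebesgue's differentiation theorem. The averages \<open>integral {x..x+h} p / h\<close> converge to \<open>p x\<close> off a
null set by \<open>integrable_ccontinuous_explicit\<close>, which only speaks of intervals to the right of \<open>x\<close>;
the left-hand averages are right-hand averages of the reflected function \<open>\<lambda>x. p (- x)\<close>.
\<close>

lemma primitive_has_derivative_AE:
  assumes p: "locally_integrable p"
  shows "AE x in lborel. ((\<lambda>x. LBINT t=ereal c..ereal x. p t) has_real_derivative p x) (at x)"
proof -
  let ?P = "\<lambda>x. LBINT t=ereal c..ereal x. p t"
  have pint: "p integrable_on {a..b}" for a b
    by (rule locally_integrable_integrable_on[OF p])
  have ri: "(\<lambda>x. p (- x)) integrable_on {a..b}" for a b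
    using pint[of "-b" "-a"] Henstock_Kurzweil_Integration.integrable_reflect_real[of p "-a" "-b"]
    by (simp del: Henstock_Kurzweil_Integration.integrable_reflect_real)
  obtain N where N: "negligible N" and N': "\<And>x e. x \<notin> N \<Longrightarrow> 0 < e \<Longrightarrow>
      \<exists>d>0. \<forall>h. 0 < h \<and> h < d \<longrightarrow> norm (integral (cbox x (x + h *\<^sub>R One)) p /\<^sub>R h ^ DIM(real) - p x) < e"
    using integrable_ccontinuous_explicit[of p] pint by (auto simp: cbox_interval)
  obtain L where L: "negligible L" and L': "\<And>x e. x \<notin> L \<Longrightarrow> 0 < e \<Longrightarrow>
      \<exists>d>0. \<forall>h. 0 < h \<and> h < d \<longrightarrow>
        norm (integral (cbox x (x + h *\<^sub>R One)) (\<lambda>x. p (- x)) /\<^sub>R h ^ DIM(real) - p (- x)) < e"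
    using integrable_ccontinuous_explicit[of "\<lambda>x. p (- x)"] ri by (auto simp: cbox_interval)
  have L2: "negligible (uminus ` L)"
    using L by (intro negligible_differentiable_image_negligible) (auto intro!: derivative_intros)
  have der: "(?P has_real_derivative p x) (at x)" if x: "x \<notin> N \<union> uminus ` L" for x
    unfolding has_field_derivative_def has_derivative_at_alt
  proof (intro conjI allI impI)
    show "bounded_linear ((*) (p x))" by (rule bounded_linear_mult_right)
    fix e :: real assume e: "e > 0"
    obtain d1 where d1: "d1 > 0" "\<And>h. 0 < h \<Longrightarrow> h < d1 \<Longrightarrow> \<bar>integral {x..x+h} p / h - p x\<bar> < e"
      using N'[of x e] e x by (auto simp: divide_inverse mult.commute)
    have "- x \<notin> L" using x by force
    from L'[OF this e] obtain d2 where d2: "d2 > 0"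
      "\<And>h. 0 < h \<Longrightarrow> h < d2 \<Longrightarrow> \<bar>integral {-x..-x+h} (\<lambda>x. p (- x)) / h - p x\<bar> < e"
      by (auto simp: divide_inverse mult.commute)
    have refl: "integral {-x..-x+h} (\<lambda>x. p (- x)) = integral {x-h..x} p" for h
      using Henstock_Kurzweil_Integration.integral_reflect_real[of x "x-h" p] by (simp add: algebra_simps)
    show "\<exists>d>0. \<forall>y. norm (y - x) < d \<longrightarrow> norm (?P y - ?P x - p x * (y - x)) \<le> e * norm (y - x)"
    proof (intro exI[of _ "min d1 d2"] conjI allI impI)
      show "min d1 d2 > 0" using d1 d2 by simp
      fix y assume y: "norm (y - x) < min d1 d2"
      consider "y = x" | "y > x" | "y < x" by linarith
      then show "norm (?P y - ?P x - p x * (y - x)) \<le> e * norm (y - x)"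
      proof cases
        case 2
        have "\<bar>integral {x..y} p / (y-x) - p x\<bar> < e"
          using d1(2)[of "y - x"] y 2 by simp
        then have "\<bar>integral {x..y} p / (y-x) - p x\<bar> * (y-x) \<le> e * (y-x)"
          using 2 by (intro mult_right_mono) auto
        also have "\<bar>integral {x..y} p / (y-x) - p x\<bar> * (y-x)
            = \<bar>(integral {x..y} p / (y-x) - p x) * (y-x)\<bar>"
          using 2 by (simp add: abs_mult)
        also have "(integral {x..y} p / (y-x) - p x) * (y-x) = integral {x..y} p - p x * (y-x)"
          using 2 by (simp add: left_diff_distrib)
        finally show ?thesis
          using 2 primitive_eq_integral[OF p, of x y c] by simp
      next
        case 3
        have "\<bar>integral {y..x} p / (x-y) - p x\<bar> < e"
          using d2(2)[of "x - y"] refl[of "x - y"] y 3 by simp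
        then have "\<bar>integral {y..x} p / (x-y) - p x\<bar> * (x-y) \<le> e * (x-y)"
          using 3 by (intro mult_right_mono) auto
        also have "\<bar>integral {y..x} p / (x-y) - p x\<bar> * (x-y)
            = \<bar>(integral {y..x} p / (x-y) - p x) * (x-y)\<bar>"
          using 3 by (simp add: abs_mult)
        also have "(integral {y..x} p / (x-y) - p x) * (x-y) = integral {y..x} p - p x * (x-y)"
          using 3 by (simp add: left_diff_distrib)
        finally show ?thesis
          using 3 primitive_eq_integral[OF p, of y x c] by (simp add: algebra_simps abs_minus_commute)
      qed simp
    qed
  qed
  have "N \<union> uminus ` L \<in> null_sets lebesgue"
    using negligible_Un[OF N L2] by (simp add: negligible_iff_null_sets)
  then have "AE x in lebesgue. x \<notin> N \<union> uminus ` L"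
    by (rule AE_not_in)
  then have "AE x in lebesgue. (?P has_real_derivative p x) (at x)"
    by eventually_elim (use der in blast)
  then show ?thesis
    by (simp add: AE_completion_iff)
qed

text \<open>
The part of the product rule that survives when \<open>p\<close> is merely locally integrable, so that its
primitive \<open>P\<close> need not be differentiable at \<open>x\<close>. The increment of the difference below contains, besides
\<open>(u y - u x) * (c + P x)\<close>, only the integral of \<open>(u y - u t) * p t\<close> over the segment between \<open>x\<close> and \<open>y\<close>.
There the kernel is of order \<open>\<bar>y - x\<bar>\<close> and the integral of \<open>\<bar>p\<bar>\<close> tends to zero, so this term
is \<open>o(y - x)\<close> at every point \<open>x\<close>, not just at almost every one.
\<close>

lemma product_defect_has_derivative:
  assumes p: "locally_integrable p" and cu: "continuous_on UNIV u"
    and u: "(u has_real_derivative u') (at x)"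
  shows "((\<lambda>x. u x * (c + (LBINT t=ereal 0..ereal x. p t)) - (LBINT t=ereal 0..ereal x. u t * p t))
           has_real_derivative u' * (c + (LBINT t=ereal 0..ereal x. p t))) (at x)"
proof -
  let ?P = "\<lambda>x. LBINT t=ereal 0..ereal x. p t"
  let ?U = "\<lambda>x. LBINT t=ereal 0..ereal x. u t * p t"
  let ?D = "\<lambda>y. u y * (?P y - ?P x) - (?U y - ?U x)"
  let ?R = "\<lambda>y. \<bar>LBINT t=ereal x..ereal y. \<bar>p t\<bar>\<bar>"
  note up = locally_integrable_mult_continuous[OF cu p]
  have D: "?D y = (LBINT t=ereal x..ereal y. (u y - u t) * p t)" for y
  proof -
    have "(LBINT t=ereal x..ereal y. (u y - u t) * p t)
        = (LBINT t=ereal x..ereal y. u y * p t - u t * p t)"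
      by (simp add: algebra_simps)
    also have "\<dots> = (LBINT t=ereal x..ereal y. u y * p t) - (LBINT t=ereal x..ereal y. u t * p t)"
      by (intro interval_lebesgue_integral_diff(2) locally_integrable_interval up
           locally_integrable_mult_continuous[of "\<lambda>_. u y", OF _ p]) auto
    also have "(LBINT t=ereal x..ereal y. u y * p t) = u y * (?P y - ?P x)"
      by (simp add: locally_integrable_interval_sum[OF p, of 0 x y, symmetric])
    finally show ?thesis
      using locally_integrable_interval_sum[OF up, of 0 x y] by linarith
  qed
  \<comment> \<open>differentiability at the single point x already gives a Lipschitz bound centred at x\<close>
  obtain d where d: "d > 0" "\<And>t. \<bar>t - x\<bar> < d \<Longrightarrow> \<bar>u t - u x\<bar> \<le> (\<bar>u'\<bar> + 1) * \<bar>t - x\<bar>"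
  proof -
    from u obtain d where d: "d > 0"
       "\<And>t. norm (t - x) < d \<Longrightarrow> norm (u t - u x - u' * (t - x)) \<le> 1 * norm (t - x)"
      unfolding has_field_derivative_def has_derivative_at_alt by (meson zero_less_one)
    have "\<bar>u t - u x\<bar> \<le> (\<bar>u'\<bar> + 1) * \<bar>t - x\<bar>" if "\<bar>t - x\<bar> < d" for t
    proof -
      have "\<bar>u t - u x\<bar> \<le> \<bar>u t - u x - u' * (t - x)\<bar> + \<bar>u' * (t - x)\<bar>" by linarith
      also have "\<dots> \<le> \<bar>t - x\<bar> + \<bar>u'\<bar> * \<bar>t - x\<bar>"
        using d(2)[of t] that by (simp add: abs_mult)
      finally show ?thesis by (simp add: algebra_simps)
    qed
    then show ?thesis using d(1) that by blast
  qed
  have bound: "\<bar>?D y\<bar> \<le> 2 * (\<bar>u'\<bar> + 1) * \<bar>y - x\<bar> * ?R y" if y: "\<bar>y - x\<bar> < d" for y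
  proof -
    let ?C = "2 * (\<bar>u'\<bar> + 1) * \<bar>y - x\<bar>"
    have C: "\<bar>u y - u t\<bar> \<le> ?C" if "min x y \<le> t" "t \<le> max x y" for t
    proof -
      have t: "\<bar>t - x\<bar> \<le> \<bar>y - x\<bar>" using that by auto
      have "\<bar>u y - u t\<bar> \<le> (\<bar>u'\<bar> + 1) * \<bar>y - x\<bar> + (\<bar>u'\<bar> + 1) * \<bar>t - x\<bar>"
        using d(2)[of y] d(2)[of t] t y by linarith
      also have "\<dots> \<le> (\<bar>u'\<bar> + 1) * \<bar>y - x\<bar> + (\<bar>u'\<bar> + 1) * \<bar>y - x\<bar>"
        using t by (intro add_left_mono mult_left_mono) auto
      finally show ?thesis by (simp add: algebra_simps)
    qed
    have q: "locally_integrable (\<lambda>t. (u y - u t) * p t)"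
      using cu by (intro locally_integrable_mult_continuous p continuous_intros)
    have mono: "(LBINT t=ereal (min x y)..ereal (max x y). \<bar>(u y - u t) * p t\<bar>)
       \<le> (LBINT t=ereal (min x y)..ereal (max x y). ?C * \<bar>p t\<bar>)"
      unfolding interval_integral_Icc[OF min.coboundedI1[OF max.cobounded1]]
    proof (rule set_integral_mono)
      show "set_integrable lborel {min x y..max x y} (\<lambda>t. \<bar>(u y - u t) * p t\<bar>)"
        using locally_integrable_abs[OF q] by (simp add: locally_integrable_def)
      show "set_integrable lborel {min x y..max x y} (\<lambda>t. ?C * \<bar>p t\<bar>)"
        using locally_integrable_mult_continuous[of "\<lambda>_. ?C", OF _ locally_integrable_abs[OF p]]
        by (simp add: locally_integrable_def)
      fix t assume "t \<in> {min x y..max x y}"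
      then show "\<bar>(u y - u t) * p t\<bar> \<le> ?C * \<bar>p t\<bar>"
        unfolding abs_mult using C[of t] by (intro mult_right_mono) auto
    qed
    have pos: "0 \<le> (LBINT t=ereal (min x y)..ereal (max x y). \<bar>(u y - u t) * p t\<bar>)"
      unfolding interval_integral_Icc[OF min.coboundedI1[OF max.cobounded1]]
        set_lebesgue_integral_def by (auto intro!: integral_nonneg_AE)
    have absmm: "\<bar>LBINT t=ereal x..ereal y. g t\<bar> = \<bar>LBINT t=ereal (min x y)..ereal (max x y). g t\<bar>" for g :: "real \<Rightarrow> real"
      by (cases "x \<le> y") (auto simp: min_def max_def interval_integral_endpoints_reverse[of "ereal x" "ereal y"])
    have "\<bar>?D y\<bar> \<le> \<bar>LBINT t=ereal x..ereal y. \<bar>(u y - u t) * p t\<bar>\<bar>"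
      using interval_integral_norm2[OF locally_integrable_interval[OF q], of x y] D[of y] by simp
    also have "\<dots> = \<bar>LBINT t=ereal (min x y)..ereal (max x y). \<bar>(u y - u t) * p t\<bar>\<bar>"
      by (rule absmm)
    also have "\<dots> \<le> \<bar>LBINT t=ereal (min x y)..ereal (max x y). ?C * \<bar>p t\<bar>\<bar>"
      using mono pos by linarith
    also have "\<dots> = ?C * \<bar>LBINT t=ereal (min x y)..ereal (max x y). \<bar>p t\<bar>\<bar>"
      by (simp add: abs_mult)
    also have "\<dots> = ?C * ?R y"
      by (simp only: absmm[of "\<lambda>t. \<bar>p t\<bar>"])
    finally show ?thesis .
  qed
  have "(?D has_real_derivative 0) (at x)"
    unfolding has_field_derivative_iff
  proof (rule Lim_null_comparison)
    show "\<forall>\<^sub>F y in at x. norm ((?D y - ?D x) / (y - x)) \<le> 2 * (\<bar>u'\<bar> + 1) * ?R y"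
      unfolding eventually_at
    proof (intro exI[of _ d] conjI ballI impI)
      fix y assume "y \<noteq> x \<and> dist y x < d"
      then show "norm ((?D y - ?D x) / (y - x)) \<le> 2 * (\<bar>u'\<bar> + 1) * ?R y"
        using bound[of y] by (simp add: dist_real_def field_simps abs_mult)
    qed (use d in auto)
    have "((\<lambda>y. 2 * (\<bar>u'\<bar> + 1) * ?R y) \<longlongrightarrow> 2 * (\<bar>u'\<bar> + 1) * ?R x) (at x)"
      using primitive_continuous[OF locally_integrable_abs[OF p], where x=x and c=x]
      by (intro tendsto_intros) (simp add: isCont_def)
    then show "((\<lambda>y. 2 * (\<bar>u'\<bar> + 1) * ?R y) \<longlongrightarrow> 0) (at x)" by simp
  qed
  moreover have "((\<lambda>y. u y * (c + ?P x) - ?U x) has_real_derivative u' * (c + ?P x)) (at x)"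
    using u by (auto intro!: derivative_eq_intros)
  ultimately have "((\<lambda>y. u y * (c + ?P x) - ?U x + ?D y) has_real_derivative u' * (c + ?P x)) (at x)"
    using DERIV_add by fastforce
  then show ?thesis by (simp add: algebra_simps)
qed

text \<open>
Integration by parts for a continuously differentiable factor and a primitive. It is obtained by applying
the fundamental theorem of calculus to the everywhere differentiable function of the previous lemma.
\<close>

lemma product_primitive:
  assumes p: "locally_integrable p"
    and u: "\<And>x. (u has_real_derivative u' x) (at x)" and cu': "continuous_on UNIV u'"
  shows "u x * (c + (LBINT t=ereal 0..ereal x. p t)) = u 0 * c +
      (LBINT t=ereal 0..ereal x. u t * p t + u' t * (c + (LBINT s=ereal 0..ereal t. p s)))"
proof -
  let ?P = "\<lambda>x. LBINT t=ereal 0..ereal x. p t"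
  let ?U = "\<lambda>x. LBINT t=ereal 0..ereal x. u t * p t"
  let ?H = "\<lambda>x. u x * (c + ?P x) - ?U x"
  have cu: "continuous_on UNIV u"
    using u by (intro DERIV_continuous_on) auto
  have cP: "continuous_on UNIV (\<lambda>t. u' t * (c + ?P t))"
    using primitive_continuous[OF p, where c=0] cu'
    by (intro continuous_intros) (auto simp: continuous_on_eq_continuous_at)
  have "(LBINT t=ereal 0..ereal x. u' t * (c + ?P t)) = ?H x - ?H 0"
  proof (rule interval_integral_FTC_finite)
    show "continuous_on {min 0 x..max 0 x} (\<lambda>t. u' t * (c + ?P t))"
      using cP by (rule continuous_on_subset) auto
    show "(?H has_vector_derivative u' y * (c + ?P y)) (at y within {min 0 x..max 0 x})" for y
      using product_defect_has_derivative[OF p cu u, where x=y and c=c]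
      by (auto simp: has_real_derivative_iff_has_vector_derivative intro: has_vector_derivative_at_within)
  qed
  moreover have "(LBINT t=ereal 0..ereal x. u t * p t + u' t * (c + ?P t))
      = ?U x + (LBINT t=ereal 0..ereal x. u' t * (c + ?P t))"
    by (intro interval_lebesgue_integral_add(2) locally_integrable_interval
         locally_integrable_mult_continuous cu p locally_integrable_continuous cP)
  ultimately show ?thesis by simp
qed

section \<open>The power series of the Bessel function of the first kind\<close>

text \<open>
The entire factor of \<open>I\<^sub>\<nu>\<close>: with \<open>z = (x/2)\<^sup>2\<close> one has \<open>I\<^sub>\<nu>(x) = (x/2)\<^sup>\<nu> * bessel_series \<nu> z\<close>.
In the variable \<open>z\<close>, differentiation is just a shift of the order \<open>\<nu>\<close>.
\<close>

definition bessel_series :: "real \<Rightarrow> real \<Rightarrow> real" where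
  "bessel_series \<nu> z = (\<Sum>k. rGamma (\<nu> + real k + 1) / fact k * z ^ k)"

lemma summable_bessel_series:
  "summable (\<lambda>k. rGamma (\<nu> + real k + 1) / fact k * z ^ k)" for \<nu> z :: real
\<comment> \<open>for such k the factor nu + k + 1 is at least 1 and k + 1 is at least twice the modulus of z\<close>
proof (rule summable_ratio_test[where c = "1/2" and N = "nat \<lceil>2 * \<bar>z\<bar> + \<bar>\<nu>\<bar>\<rceil>"])
  fix k assume "nat \<lceil>2 * \<bar>z\<bar> + \<bar>\<nu>\<bar>\<rceil> \<le> k"
  then have k: "real k \<ge> 2 * \<bar>z\<bar> + \<bar>\<nu>\<bar>" by linarith
  have r: "rGamma (\<nu> + real k + 1) = (\<nu> + real k + 1) * rGamma (\<nu> + real (Suc k) + 1)"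
    using rGamma_plus1[of "\<nu> + real k + 1"] by (simp add: algebra_simps)
  have "\<bar>z\<bar> * 2 \<le> (\<nu> + real k + 1) * (real k + 1)"
  proof -
    have "1 * (real k + 1) \<le> (\<nu> + real k + 1) * (real k + 1)"
      using k by (intro mult_right_mono) auto
    moreover have "\<bar>z\<bar> * 2 \<le> 1 * (real k + 1)"
      using k abs_ge_zero[of \<nu>] by (simp add: mult.commute)
    ultimately show ?thesis by (rule order.trans[rotated])
  qed
  then have z: "\<bar>z\<bar> / (real k + 1) \<le> 1/2 * \<bar>\<nu> + real k + 1\<bar>"
    using k by (simp add: divide_simps abs_if split: if_splits)
  let ?R = "\<bar>rGamma (\<nu> + real (Suc k) + 1)\<bar> / fact k * \<bar>z\<bar> ^ k"
  have "norm (rGamma (\<nu> + real (Suc k) + 1) / fact (Suc k) * z ^ Suc k) = \<bar>z\<bar> / (real k + 1) * ?R"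
    by (simp add: abs_mult power_abs abs_divide mult_ac)
  also have "\<dots> \<le> 1/2 * \<bar>\<nu> + real k + 1\<bar> * ?R"
    using z by (intro mult_right_mono) auto
  also have "\<dots> = 1/2 * norm (rGamma (\<nu> + real k + 1) / fact k * z ^ k)"
    unfolding r by (simp add: abs_mult power_abs)
  finally show "norm (rGamma (\<nu> + real (Suc k) + 1) / fact (Suc k) * z ^ Suc k)
         \<le> 1/2 * norm (rGamma (\<nu> + real k + 1) / fact k * z ^ k)" .
qed simp

lemma diffs_bessel_series:
  "diffs (\<lambda>k. rGamma (\<nu> + real k + 1) / fact k) k = rGamma (\<nu> + 1 + real k + 1) / fact k"
proof -
  have "fact (Suc k) = real (Suc k) * fact k" by simp
  then show ?thesis by (simp add: diffs_def add_ac del: fact_Suc)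
qed

lemma bessel_series_has_derivative:
  "(bessel_series \<nu> has_real_derivative bessel_series (\<nu> + 1) z) (at z)"
proof -
  have "((\<lambda>z. \<Sum>k. rGamma (\<nu> + real k + 1) / fact k * z ^ k) has_real_derivative
     (\<Sum>k. diffs (\<lambda>k. rGamma (\<nu> + real k + 1) / fact k) k * z ^ k)) (at z)"
    by (rule termdiffs_strong_converges_everywhere) (rule summable_bessel_series)
  then show ?thesis
    unfolding diffs_bessel_series bessel_series_def[abs_def] .
qed

text \<open>
This is \<open>(\<nu> + k + 1) / \<Gamma>(\<nu> + k + 2) = 1 / \<Gamma>(\<nu> + k + 1)\<close> read coefficientwise; for the total reciprocal
Gamma function it also holds at the poles, so no order is exceptional. Together with the shift rule for
derivatives it is the modified Bessel equation in the variable \<open>z\<close>.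
\<close>

lemma bessel_series_recurrence:
  "bessel_series \<nu> z = (\<nu> + 1) * bessel_series (\<nu> + 1) z + z * bessel_series (\<nu> + 2) z"
proof -
  let ?c = "\<lambda>k. rGamma (\<nu> + 1 + real k + 1) / fact k"
  have "(\<lambda>k. diffs ?c k * z ^ k) sums bessel_series (\<nu> + 2) z"
    unfolding diffs_bessel_series bessel_series_def
    using summable_sums[OF summable_bessel_series[of "\<nu> + 2" z]] by (simp add: add_ac)
  then have "(\<lambda>k. z * (diffs ?c k * z ^ k)) sums (z * bessel_series (\<nu> + 2) z)"
    by (rule sums_mult)
  then have "(\<lambda>k. real (Suc k) * ?c (Suc k) * z ^ Suc k) sums (z * bessel_series (\<nu> + 2) z)"
    by (simp add: diffs_def mult_ac)
  then have 1: "(\<lambda>k. real k * ?c k * z ^ k) sums (z * bessel_series (\<nu> + 2) z)"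
    by (subst (asm) sums_Suc_iff) simp
  have 2: "(\<lambda>k. (\<nu> + 1) * (?c k * z ^ k)) sums ((\<nu> + 1) * bessel_series (\<nu> + 1) z)"
    unfolding bessel_series_def by (intro sums_mult summable_sums summable_bessel_series)
  have r: "rGamma (\<nu> + real k + 1) = (\<nu> + real k + 1) * rGamma (\<nu> + 1 + real k + 1)" for k
    using rGamma_plus1[of "\<nu> + real k + 1"] by (simp add: algebra_simps)
  have "(\<lambda>k. rGamma (\<nu> + real k + 1) / fact k * z ^ k) sums
      ((\<nu> + 1) * bessel_series (\<nu> + 1) z + z * bessel_series (\<nu> + 2) z)"
    using sums_add[OF 2 1] unfolding r by (simp add: algebra_simps add_divide_distrib)
  then show ?thesis
    unfolding bessel_series_def[of \<nu>] by (rule sums_unique[symmetric])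
qed

lemma bessel_I_eq_bessel_series:
  assumes "x > 0"
  shows "bessel_I \<nu> x = (x / 2) powr \<nu> * bessel_series \<nu> ((x / 2)\<^sup>2)"
proof -
  have "rGamma (\<nu> + real k + 1) / fact k * (x / 2) powr (\<nu> + 2 * real k)
     = (x / 2) powr \<nu> * (rGamma (\<nu> + real k + 1) / fact k * ((x / 2)\<^sup>2) ^ k)" for k
  proof -
    have "(x / 2) powr (2 * real k) = ((x / 2)\<^sup>2) ^ k"
      using assms powr_realpow[of "x/2" "2 * k"] by (simp add: power_mult)
    then show ?thesis by (simp add: powr_add)
  qed
  then show ?thesis
    unfolding bessel_I_def bessel_series_def
    by (simp only: suminf_mult[OF summable_bessel_series])
qed


section \<open>Generalized inverse Gaussian integrals and the Bessel function of the second kind\<close>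

text \<open>
The unnormalised density of the generalized inverse Gaussian distribution. Its total mass over the
half-line is \<open>2 * (q/p) powr (\<mu>/2) * K\<^sub>\<mu>(2 * sqrt (p * q))\<close>. This form of \<open>K\<close> makes the differential
equation, the limit at zero and the Gaussian mixture behind the generalized hyperbolic law all elementary.
\<close>

definition gig_kernel :: "real \<Rightarrow> real \<Rightarrow> real \<Rightarrow> real \<Rightarrow> real" where
  "gig_kernel \<mu> p q v = v powr (\<mu> - 1) * exp (- (p * v) - q / v)"

definition gig_integral :: "real \<Rightarrow> real \<Rightarrow> real \<Rightarrow> real" where
  "gig_integral \<mu> p q = (LBINT v:{0<..}. gig_kernel \<mu> p q v)"

lemma gig_kernel_nonneg: "gig_kernel \<mu> p q v \<ge> 0"
  by (simp add: gig_kernel_def)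

lemma gig_kernel_measurable [measurable]: "gig_kernel \<mu> p q \<in> borel_measurable borel"
  unfolding gig_kernel_def[abs_def] by measurable

lemma gig_integrable_Gamma:
  assumes "\<mu> > 0" "p > 0"
  shows "set_integrable lborel {0<..} (gig_kernel \<mu> p 0)"
proof -
  have "(\<lambda>t. complex_of_real t powr (of_real \<mu> - 1) / of_real (exp (p * t))) absolutely_integrable_on {0<..}"
    using assms by (intro absolutely_integrable_Gamma_integral) auto
  then have "set_integrable lebesgue {0<..} (\<lambda>t. norm (complex_of_real t powr (of_real \<mu> - 1) / of_real (exp (p * t))))"
    by (rule set_integrable_norm)
  also have "?this \<longleftrightarrow> set_integrable lebesgue {0<..} (gig_kernel \<mu> p 0)"
    by (intro set_integrable_cong refl)
      (auto simp: gig_kernel_def norm_divide norm_powr_real_powr exp_minus field_simps)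
  finally show ?thesis
    unfolding set_integrable_def by (subst (asm) integrable_completion) auto
qed

lemma power_le_fact_exp:
  assumes "(y::real) \<ge> 0"
  shows "y ^ n \<le> fact n * exp y"
proof -
  have s: "(\<lambda>n. y ^ n /\<^sub>R fact n) sums exp y" by (rule exp_converges)
  have "sum (\<lambda>n. y ^ n /\<^sub>R fact n) {n} \<le> (\<Sum>n. y ^ n /\<^sub>R fact n)"
    using s assms by (intro sum_le_suminf) (auto simp: sums_iff)
  then show ?thesis
    using s by (simp add: sums_iff field_simps)
qed

text \<open>
At the origin the factor \<open>exp (- q / v)\<close> beats every power of \<open>v\<close>. Trading it for \<open>v ^ n\<close> reduces all
integrability questions to the Gamma integral.
\<close>

lemma gig_kernel_le:
  assumes "v > 0" "q > 0"
  shows "gig_kernel \<mu> p q v \<le> fact n / q ^ n * gig_kernel (\<mu> + real n) p 0 v"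
proof -
  have "(q / v) ^ n \<le> fact n * exp (q / v)"
    using assms by (intro power_le_fact_exp) auto
  then have "exp (- (q / v)) \<le> fact n / q ^ n * v ^ n"
    using assms by (simp add: exp_minus power_divide divide_simps mult_ac)
  then have "v powr (\<mu> - 1) * exp (- (p * v)) * exp (- (q / v))
      \<le> v powr (\<mu> - 1) * exp (- (p * v)) * (fact n / q ^ n * v ^ n)"
    by (intro mult_left_mono) auto
  moreover have "v powr (\<mu> + real n - 1) = v powr (\<mu> - 1) * v ^ n"
    using assms powr_add[of v "\<mu> - 1" "real n"] by (simp add: powr_realpow algebra_simps)
  ultimately show ?thesis
    by (simp add: gig_kernel_def exp_diff exp_minus field_simps)
qed

lemma gig_integrable:
  assumes "p > 0" "q > 0"
  shows "set_integrable lborel {0<..} (gig_kernel \<mu> p q)"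
proof -
  obtain n :: nat where n: "\<mu> + real n > 0"
    using reals_Archimedean2[of "- \<mu>"] by (metis add.commute diff_gt_0_iff_gt diff_minus_eq_add)
  have "set_integrable lborel {0<..} (\<lambda>v. fact n / q ^ n * gig_kernel (\<mu> + real n) p 0 v)"
    using assms n by (intro set_integrable_mult_right impI gig_integrable_Gamma) auto
  then show ?thesis
  proof (rule set_integrable_bound)
    show "set_borel_measurable lborel {0<..} (gig_kernel \<mu> p q)"
      by (simp add: set_borel_measurable_def)
    show "AE v in lborel. v \<in> {0<..} \<longrightarrow>
        norm (gig_kernel \<mu> p q v) \<le> norm (fact n / q ^ n * gig_kernel (\<mu> + real n) p 0 v)"
      using gig_kernel_le[OF _ assms(2)]
      by (intro AE_I2 impI) (force simp only: gig_kernel_nonneg real_norm_def abs_of_nonneg greaterThan_iff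
            intro: order.trans[OF _ abs_ge_self])
  qed
qed

lemma gig_integral_pos:
  assumes "p > 0" "q > 0"
  shows "gig_integral \<mu> p q > 0"
proof -
  let ?f = "\<lambda>v. indicator {0<..} v *\<^sub>R gig_kernel \<mu> p q v"
  have i: "integrable lborel ?f" using gig_integrable[OF assms] by (simp add: set_integrable_def)
  have nn: "AE v in lborel. 0 \<le> ?f v" by (auto simp: gig_kernel_nonneg)
  \<comment> \<open>an integrand that is positive on (0,1) cannot vanish almost everywhere\<close>
  have "integral\<^sup>L lborel ?f \<noteq> 0"
  proof
    assume "integral\<^sup>L lborel ?f = 0"
    then have "AE v in lborel. ?f v = 0"
      using integral_nonneg_eq_0_iff_AE[OF i nn] by simp
    then have "AE v in lborel. v \<notin> {0<..<1::real}"
      by eventually_elim (auto simp: gig_kernel_def)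
    then have "emeasure lborel {0<..<1::real} = 0"
      by (subst (asm) AE_iff_measurable[where N="{0<..<1}"]) auto
    then show False by simp
  qed
  moreover have "integral\<^sup>L lborel ?f \<ge> 0" using nn by (rule integral_nonneg_AE)
  ultimately show ?thesis
    unfolding gig_integral_def set_lebesgue_integral_def by linarith
qed

lemma exp_taylor_bound:
  fixes y y' m :: real
  assumes "m \<le> y" "m \<le> y'"
  shows "\<bar>exp (- y') - exp (- y) + (y' - y) * exp (- y)\<bar> \<le> (y' - y)\<^sup>2 * exp (- m)"
proof -
  let ?w = "y' - y"
  have e: "exp (- y') = exp (- y) * exp (- ?w)" by (simp flip: exp_add)
  have eq: "exp (- y') - exp (- y) + ?w * exp (- y) = exp (- y) * (exp (- ?w) - 1 + ?w)"
    unfolding e by (simp add: algebra_simps)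
  have nn: "exp (- ?w) - 1 + ?w \<ge> 0" using exp_ge_add_one_self[of "- ?w"] by linarith
  have "exp (- y) * (exp (- ?w) - 1 + ?w) \<le> ?w\<^sup>2 * exp (- m)"
  proof (cases "?w \<ge> 0")
    case True
    have "exp (- ?w) * (1 + ?w) \<le> exp (- ?w) * exp ?w"
      using exp_ge_add_one_self[of ?w] by (intro mult_left_mono) auto
    also have "\<dots> = 1" by (simp flip: exp_add)
    also have "1 \<le> (1 - ?w + ?w\<^sup>2) * (1 + ?w)"
    proof -
      have "(1 - ?w + ?w\<^sup>2) * (1 + ?w) = 1 + ?w ^ 3" by algebra
      then show ?thesis using True by simp
    qed
    finally have "exp (- ?w) \<le> 1 - ?w + ?w\<^sup>2"
      using True by (metis mult_right_le_imp_le add_pos_nonneg zero_less_one)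
    then have "exp (- y) * (exp (- ?w) - 1 + ?w) \<le> exp (- m) * ?w\<^sup>2"
      using nn assms by (intro mult_mono) auto
    then show ?thesis by (simp add: mult.commute)
  next
    case False
    have "exp (- y) * (exp (- ?w) - 1 + ?w) = exp (- y') * (1 - (1 - ?w) * exp ?w)"
      by (simp add: algebra_simps flip: exp_add)
    also have "\<dots> \<le> exp (- m) * ?w\<^sup>2"
    proof (rule mult_mono)
      have "(1 - ?w) * (1 + ?w) \<le> (1 - ?w) * exp ?w"
        using False exp_ge_add_one_self[of ?w] by (intro mult_left_mono) auto
      then show "1 - (1 - ?w) * exp ?w \<le> ?w\<^sup>2" by (simp add: power2_eq_square algebra_simps)
      have "(1 - ?w) * exp ?w \<le> exp (- ?w) * exp ?w"
        using exp_ge_add_one_self[of "- ?w"] by (intro mult_right_mono) (linarith, simp)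
      also have "\<dots> = 1" by (simp flip: exp_add)
      finally show "0 \<le> 1 - (1 - ?w) * exp ?w" by simp
    qed (use assms in auto)
    finally show ?thesis by (simp add: mult.commute)
  qed
  then show ?thesis unfolding eq using nn by simp
qed

lemma gig_kernel_lower:
  "v > 0 \<Longrightarrow> gig_kernel (\<mu> - 1) p q v = gig_kernel \<mu> p q v / v"
  "v > 0 \<Longrightarrow> gig_kernel (\<mu> + 1) p q v = v * gig_kernel \<mu> p q v"
  by (simp_all add: gig_kernel_def powr_diff powr_add power2_eq_square)

text \<open>
A first-order Taylor estimate in \<open>q\<close> with quadratic error, obtained pointwise in \<open>v\<close> and then integrated.
It gives differentiability under the integral sign without any limit theorem for integrals.
\<close>

lemma gig_integral_taylor:
  assumes p: "p > 0" and m: "m > 0" "m \<le> q" "m \<le> q'"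
  shows "\<bar>gig_integral \<mu> p q' - gig_integral \<mu> p q + (q' - q) * gig_integral (\<mu> - 1) p q\<bar>
     \<le> (q' - q)\<^sup>2 * gig_integral (\<mu> - 2) p m"
proof -
  let ?g = "\<lambda>v. gig_kernel \<mu> p q' v - gig_kernel \<mu> p q v + (q' - q) * gig_kernel (\<mu> - 1) p q v"
  have I: "set_integrable lborel {0<..} (gig_kernel \<mu> p q)" if "q > 0" for \<mu> q
    using gig_integrable[OF p that] .
  have ig: "set_integrable lborel {0<..} ?g"
    using m by (intro set_integral_add set_integral_diff set_integrable_mult_right impI I) auto
  have eq: "gig_integral \<mu> p q' - gig_integral \<mu> p q + (q' - q) * gig_integral (\<mu> - 1) p q
     = (LBINT v:{0<..}. ?g v)"
    unfolding gig_integral_def using m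
    by (subst set_integral_add(2), (intro set_integral_diff set_integrable_mult_right impI I; simp)+)
       (subst set_integral_diff(2), (intro I; simp)+,
        subst set_integral_mult_right, rule refl)
  have "\<bar>LBINT v:{0<..}. ?g v\<bar> \<le> (LBINT v:{0<..}. \<bar>?g v\<bar>)"
    using set_integral_norm_bound[OF ig] by simp
  also have "\<dots> \<le> (LBINT v:{0<..}. (q' - q)\<^sup>2 * gig_kernel (\<mu> - 2) p m v)"
  proof (rule set_integral_mono)
    show "set_integrable lborel {0<..} (\<lambda>v. \<bar>?g v\<bar>)" using ig by (rule set_integrable_abs)
    show "set_integrable lborel {0<..} (\<lambda>v. (q' - q)\<^sup>2 * gig_kernel (\<mu> - 2) p m v)"
      using m by (intro set_integrable_mult_right impI I) auto
    fix v :: real assume "v \<in> {0<..}"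
    then have v: "v > 0" by simp
    let ?c = "v powr (\<mu> - 1) * exp (- (p * v))"
    have k: "gig_kernel \<mu> p q v = ?c * exp (- (q / v))" for q
      by (simp add: gig_kernel_def exp_diff exp_minus field_simps)
    have k2: "gig_kernel (\<mu> - 2) p m v = ?c * exp (- (m / v)) / v\<^sup>2"
    proof -
      have "gig_kernel (\<mu> - 1 - 1) p m v = gig_kernel \<mu> p m v / v / v"
        by (simp only: gig_kernel_lower(1)[OF v])
      moreover have "gig_kernel \<mu> p m v / v / v = gig_kernel \<mu> p m v / v\<^sup>2"
        by (simp only: power2_eq_square divide_divide_eq_left)
      ultimately show ?thesis by (simp add: k)
    qed
    have k1: "gig_kernel (\<mu> - 1) p q v = ?c * exp (- (q / v)) / v"
      using v gig_kernel_lower(1)[of v \<mu> p q] by (simp add: k)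
    have "\<bar>?g v\<bar> = ?c * \<bar>exp (- (q' / v)) - exp (- (q / v)) + (q' / v - q / v) * exp (- (q / v))\<bar>"
    proof -
      have "?g v = ?c * (exp (- (q' / v)) - exp (- (q / v)) + (q' / v - q / v) * exp (- (q / v)))"
        unfolding k1 k by (simp add: algebra_simps diff_divide_distrib)
      then show ?thesis by (simp add: abs_mult)
    qed
    also have "\<dots> \<le> ?c * ((q' / v - q / v)\<^sup>2 * exp (- (m / v)))"
      using m v by (intro mult_left_mono exp_taylor_bound divide_right_mono) auto
    also have "\<dots> = (q' - q)\<^sup>2 * gig_kernel (\<mu> - 2) p m v"
      unfolding k2 by (simp add: power_divide flip: diff_divide_distrib)
    finally show "\<bar>?g v\<bar> \<le> (q' - q)\<^sup>2 * gig_kernel (\<mu> - 2) p m v" .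
  qed
  also have "\<dots> = (q' - q)\<^sup>2 * gig_integral (\<mu> - 2) p m"
    by (simp add: gig_integral_def)
  finally show ?thesis unfolding eq .
qed

lemma gig_integral_has_derivative:
  assumes "p > 0" "q > 0"
  shows "(gig_integral \<mu> p has_real_derivative - gig_integral (\<mu> - 1) p q) (at q)"
  unfolding has_field_derivative_iff
proof (rule LIM_zero_cancel, rule Lim_null_comparison)
  let ?K = "gig_integral (\<mu> - 2) p (q / 2)"
  show "\<forall>\<^sub>F y in at q. norm ((gig_integral \<mu> p y - gig_integral \<mu> p q) / (y - q) - - gig_integral (\<mu> - 1) p q) \<le> \<bar>y - q\<bar> * ?K"
    unfolding eventually_at
  proof (intro exI[of _ "q/2"] conjI ballI impI)
    fix y assume y: "y \<noteq> q \<and> dist y q < q / 2"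
    have "q / 2 \<le> y" using y unfolding dist_real_def by linarith
    then have "\<bar>gig_integral \<mu> p y - gig_integral \<mu> p q + (y - q) * gig_integral (\<mu> - 1) p q\<bar> \<le> (y - q)\<^sup>2 * ?K"
      using assms by (intro gig_integral_taylor) auto
    then have "\<bar>gig_integral \<mu> p y - gig_integral \<mu> p q + (y - q) * gig_integral (\<mu> - 1) p q\<bar> / \<bar>y - q\<bar>
       \<le> (y - q)\<^sup>2 * ?K / \<bar>y - q\<bar>"
      by (rule divide_right_mono) simp
    also have "(y - q)\<^sup>2 * ?K / \<bar>y - q\<bar> = \<bar>y - q\<bar> * ?K"
    proof -
      have "(y - q)\<^sup>2 = \<bar>y - q\<bar> * \<bar>y - q\<bar>" by (simp add: power2_eq_square)
      then show ?thesis using y by (simp del: abs_mult_self_eq)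
    qed
    finally show "norm ((gig_integral \<mu> p y - gig_integral \<mu> p q) / (y - q) - - gig_integral (\<mu> - 1) p q) \<le> \<bar>y - q\<bar> * ?K"
      using y by (simp add: add_divide_distrib flip: abs_divide)
  qed (use assms in auto)
  show "((\<lambda>y. \<bar>y - q\<bar> * ?K) \<longlongrightarrow> 0) (at q)"
    by (auto intro!: tendsto_eq_intros)
qed

text \<open>
The three terms are the three parts of the derivative of \<open>v powr \<mu> * exp (- (p * v) - q / v)\<close>, a function that
vanishes at both ends of the half-line. For \<open>p = 1\<close> this is the three-term recurrence of \<open>K\<^sub>\<mu>\<close>.
\<close>

lemma gig_integral_recurrence:
  assumes p: "p > 0" and q: "q > 0"
  shows "p * gig_integral (\<mu> + 1) p q = \<mu> * gig_integral \<mu> p q + q * gig_integral (\<mu> - 1) p q"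
proof -
  let ?F = "\<lambda>v::real. v powr \<mu> * exp (- (p * v) - q / v)"
  let ?f = "\<lambda>v. \<mu> * gig_kernel \<mu> p q v + q * gig_kernel (\<mu> - 1) p q v - p * gig_kernel (\<mu> + 1) p q v"
  note I = gig_integrable[OF p q]
  have fi: "set_integrable lborel {0<..} ?f"
    by (intro set_integral_add set_integral_diff set_integrable_mult_right impI I)
  have f_eq: "?f v = \<mu> * v powr (\<mu> - 1) * exp (- (p * v) - q / v)
      + (q * v powr (\<mu> - 2) - p * v powr \<mu>) * exp (- (p * v) - q / v)" for v
    by (simp add: gig_kernel_def algebra_simps)
  have "(LBINT v=0..\<infinity>. ?f v) = 0 - 0"
  proof (rule interval_integral_FTC_integrable)
    fix v :: real assume "0 < ereal v"
    then have v: "v > 0" by simp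
    have "((\<lambda>v. exp (- (p * v) - q / v)) has_real_derivative
        exp (- (p * v) - q / v) * (q / v\<^sup>2 - p)) (at v)"
      using v by (auto intro!: derivative_eq_intros simp: power2_eq_square)
    from DERIV_mult[OF has_real_derivative_powr[OF v, of \<mu>] this]
    have "(?F has_real_derivative \<mu> * v powr (\<mu> - 1) * exp (- (p * v) - q / v)
        + exp (- (p * v) - q / v) * (q / v\<^sup>2 - p) * v powr \<mu>) (at v)" .
    moreover have "v powr (\<mu> - 2) = v powr \<mu> / v\<^sup>2"
      using v powr_diff[of v \<mu> 2] by simp
    ultimately have "(?F has_real_derivative ?f v) (at v)"
      unfolding f_eq by (simp add: algebra_simps)
    then show "(?F has_vector_derivative ?f v) (at v)"
      by (simp add: has_real_derivative_iff_has_vector_derivative)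
    show "isCont ?f v"
      unfolding f_eq using v by (intro continuous_intros) auto
  next
    show "set_integrable lborel (einterval 0 \<infinity>) ?f"
      using fi by (simp add: einterval_def greaterThan_def zero_ereal_def)
    have "(?F \<longlongrightarrow> 0) (at_right 0)" using p q by real_asymp
    then show "((?F \<circ> real_of_ereal) \<longlongrightarrow> 0) (at_right 0)"
      by (simp add: zero_ereal_def ereal_tendsto_simps)
    have "(?F \<longlongrightarrow> 0) at_top" using p q by real_asymp
    then show "((?F \<circ> real_of_ereal) \<longlongrightarrow> 0) (at_left \<infinity>)"
      by (simp add: ereal_tendsto_simps)
  qed simp
  then have "0 = (LBINT v:{0<..}. ?f v)"
    by (simp add: zero_ereal_def interval_integral_to_infinity_eq)
  also have "\<dots> = \<mu> * gig_integral \<mu> p q + q * gig_integral (\<mu> - 1) p q - p * gig_integral (\<mu> + 1) p q"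
    unfolding gig_integral_def
    by (subst set_integral_diff(2), (intro set_integral_add set_integrable_mult_right impI I)+)
       (subst set_integral_add(2), (intro set_integrable_mult_right impI I)+, simp)
  finally show ?thesis by simp
qed

text \<open>
Under \<open>v = sqrt (q/p) * exp t\<close> the exponent \<open>p * v + q / v\<close> becomes \<open>2 * sqrt (p * q) * cosh t\<close>. The integral over
the whole line of \<open>exp (\<mu> * t - s * cosh t)\<close> folds to the half-line at \<open>t = 0\<close>, because averaging over
\<open>t\<close> and \<open>- t\<close> turns \<open>exp (\<mu> * t)\<close> into \<open>cosh (\<mu> * t)\<close>.
\<close>

lemma gig_integral_eq_bessel_K:
  assumes p: "p > 0" and q: "q > 0"
  shows "gig_integral \<mu> p q = 2 * (q / p) powr (\<mu> / 2) * bessel_K \<mu> (2 * sqrt (p * q))"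
proof -
  define c where "c = sqrt (q / p)"
  define s where "s = 2 * sqrt (p * q)"
  have c: "c > 0" using p q by (simp add: c_def)
  have pc: "p * c = s / 2" "q / c = s / 2"
    using p q by (simp_all add: c_def s_def real_sqrt_divide real_sqrt_mult field_simps)
  let ?\<phi> = "\<lambda>t. exp (\<mu> * t - s * cosh t)"
  let ?\<psi> = "\<lambda>t. exp (- s * cosh t) * cosh (\<mu> * t)"
  have img: "(\<lambda>t. c * exp t) ` UNIV = {0<..}"
  proof (intro equalityI subsetI)
    fix v :: real assume "v \<in> {0<..}"
    then have "v = c * exp (ln (v / c))" using c by (simp add: exp_ln)
    then show "v \<in> range (\<lambda>t. c * exp t)" by blast
  qed (use c in auto)
  have k: "\<bar>c * exp t\<bar> * gig_kernel \<mu> p q (c * exp t) = c powr \<mu> * ?\<phi> t" for t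
  proof -
    have e: "- (p * (c * exp t)) - q / (c * exp t) = - s * cosh t"
    proof -
      have e1: "p * (c * exp t) = (s / 2) * exp t"
        unfolding pc(1)[symmetric] by simp
      have e2: "q / (c * exp t) = (s / 2) * exp (- t)"
        unfolding pc(2)[symmetric] by (simp add: exp_minus divide_inverse)
      show ?thesis unfolding e1 e2 by (simp add: cosh_def distrib_left)
    qed
    have "(c * exp t) powr (\<mu> - 1) * (c * exp t) = (c * exp t) powr \<mu>"
      using c by (simp add: powr_diff)
    also have "\<dots> = c powr \<mu> * exp (\<mu> * t)"
      using c by (simp add: powr_def ln_mult distrib_left exp_add)
    finally show ?thesis
      using c unfolding gig_kernel_def e exp_diff exp_minus
      by (simp add: exp_minus abs_mult field_simps)
  qed
  have abs: "gig_kernel \<mu> p q absolutely_integrable_on {0<..}"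
    using gig_integrable[OF p q] unfolding set_integrable_def by (subst integrable_completion) auto
  have J: "integral {0<..} (gig_kernel \<mu> p q) = gig_integral \<mu> p q"
    unfolding gig_integral_def by (rule set_borel_integral_eq_integral(2)[OF gig_integrable[OF p q], symmetric])
  have "(\<lambda>t. \<bar>c * exp t\<bar> * gig_kernel \<mu> p q (c * exp t)) absolutely_integrable_on UNIV \<and>
     integral UNIV (\<lambda>t. \<bar>c * exp t\<bar> * gig_kernel \<mu> p q (c * exp t)) = gig_integral \<mu> p q"
  proof -
    have inj: "inj (\<lambda>t. c * exp t)" using c by (auto intro!: inj_onI)
    have der: "((\<lambda>t. c * exp t) has_real_derivative c * exp t) (at t)" for t
      by (auto intro!: derivative_eq_intros)
    have "UNIV \<in> sets lebesgue" by simp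
    from has_absolute_integral_change_of_variables_1'[OF this der inj,
        of "gig_kernel \<mu> p q" "gig_integral \<mu> p q"]
    show ?thesis using abs J unfolding img by blast
  qed
  then have subst: "(\<lambda>t. c powr \<mu> * ?\<phi> t) absolutely_integrable_on UNIV \<and>
     integral UNIV (\<lambda>t. c powr \<mu> * ?\<phi> t) = gig_integral \<mu> p q"
    by (simp only: k)
  then have *: "integral UNIV (\<lambda>t. c powr \<mu> * ?\<phi> t) = gig_integral \<mu> p q"
    by (rule conjunct2)
  have "continuous_on UNIV (\<lambda>t. c powr \<mu> * ?\<phi> t)"
    by (intro continuous_intros)
  then have "(\<lambda>t. c powr \<mu> * ?\<phi> t) \<in> borel_measurable lborel"
    by (simp add: borel_measurable_continuous_onI)
  from integrable_completion[OF this] conjunct1[OF subst]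
  have "integrable lborel (\<lambda>t. c powr \<mu> * ?\<phi> t)"
    by (simp add: set_integrable_def)
  then have \<phi>: "integrable lborel ?\<phi>" using c by simp
  then have \<phi>': "integrable lborel (\<lambda>t. ?\<phi> (- t))"
    using lborel_integrable_real_affine_iff[of "-1" ?\<phi> 0] by simp
  have refl: "integral\<^sup>L lborel (\<lambda>t. ?\<phi> (- t)) = integral\<^sup>L lborel ?\<phi>"
    using lborel_integral_real_affine[of "-1" ?\<phi> 0] by simp
  have \<psi>_eq: "?\<psi> t = (?\<phi> t + ?\<phi> (- t)) / 2" for t
    by (simp add: cosh_def[of "\<mu> * t"] exp_diff exp_minus field_simps)
  have \<psi>: "integrable lborel ?\<psi>" unfolding \<psi>_eq using \<phi> \<phi>' by simp
  have "has_bochner_integral lborel ?\<psi> (2 *\<^sub>R bessel_K \<mu> s)"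
  proof (rule has_bochner_integral_even_function)
    have "integrable lborel (\<lambda>t. indicator {0..} t *\<^sub>R ?\<psi> t)"
      using \<psi> by (intro integrable_mult_indicator) auto
    then show "has_bochner_integral lborel (\<lambda>t. indicator {0..} t *\<^sub>R ?\<psi> t) (bessel_K \<mu> s)"
      by (simp add: has_bochner_integral_iff bessel_K_def set_lebesgue_integral_def)
  qed simp
  then have "2 * bessel_K \<mu> s = integral\<^sup>L lborel ?\<psi>"
    by (simp add: has_bochner_integral_iff)
  also have "\<dots> = integral\<^sup>L lborel ?\<phi>"
    unfolding \<psi>_eq using \<phi> \<phi>' refl by simp
  finally have K: "integral\<^sup>L lborel ?\<phi> = 2 * bessel_K \<mu> s" ..
  have "gig_integral \<mu> p q = c powr \<mu> * integral UNIV ?\<phi>"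
    using * by simp
  also have "integral UNIV ?\<phi> = integral\<^sup>L lborel ?\<phi>"
    by (rule integral_lborel[OF \<phi>])
  also have "c powr \<mu> = (q / p) powr (\<mu> / 2)"
    using p q by (simp add: c_def powr_half_sqrt[symmetric] powr_powr)
  finally have "gig_integral \<mu> p q = (q / p) powr (\<mu> / 2) * (2 * bessel_K \<mu> s)"
    unfolding K .
  then show ?thesis by (simp add: s_def)
qed

lemma bessel_K_minus: "bessel_K (- \<mu>) s = bessel_K \<mu> s"
  by (simp add: bessel_K_def)

lemma bessel_K_pos:
  assumes "s > 0"
  shows "bessel_K \<mu> s > 0"
proof -
  have "gig_integral \<mu> 1 ((s / 2)\<^sup>2) = 2 * ((s / 2)\<^sup>2) powr (\<mu> / 2) * bessel_K \<mu> s"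
    using assms gig_integral_eq_bessel_K[of 1 "(s / 2)\<^sup>2" \<mu>] by (simp add: real_sqrt_abs)
  moreover have "gig_integral \<mu> 1 ((s / 2)\<^sup>2) > 0"
    using assms by (intro gig_integral_pos) auto
  ultimately show ?thesis
    by (simp add: zero_less_mult_iff)
qed

text \<open>
The symmetry of \<open>K\<close> in its order. For \<open>\<mu> < 0\<close> it expresses an integral that is unbounded as \<open>q\<close> tends
to zero by one that stays bounded.
\<close>

lemma gig_integral_uminus:
  assumes "q > 0"
  shows "gig_integral \<mu> 1 q = q powr \<mu> * gig_integral (- \<mu>) 1 q"
proof -
  have "q powr (\<mu> / 2) = q powr \<mu> * q powr (- (\<mu> / 2))"
    by (simp flip: powr_add)
  then show ?thesis
    using assms by (simp add: gig_integral_eq_bessel_K bessel_K_minus)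
qed

text \<open>
Since \<open>0 \<le> 1 - exp (- q / v) \<le> q / v\<close>, the difference to the Gamma integral is at most \<open>q\<close> times the Gamma
integral of order \<open>\<mu> - 1\<close>, which is finite for \<open>\<mu> > 1\<close>.
\<close>

lemma gig_integral_tendsto_Gamma:
  assumes \<mu>: "\<mu> > 1"
  shows "(gig_integral \<mu> 1 \<longlongrightarrow> Gamma \<mu>) (at_right 0)"
proof (rule LIM_zero_cancel, rule Lim_null_comparison)
  have G: "(LBINT v:{0<..}. gig_kernel \<mu> 1 0 v) = Gamma \<mu>"
  proof -
    have "((\<lambda>t. t powr (\<mu> - 1) / exp t) has_integral Gamma \<mu>) {0..}"
      using \<mu> by (intro Gamma_integral_real) auto
    then have "(gig_kernel \<mu> 1 0 has_integral Gamma \<mu>) {0..}"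
      by (rule has_integral_eq[rotated]) (simp add: gig_kernel_def exp_minus field_simps)
    then have "(gig_kernel \<mu> 1 0 has_integral Gamma \<mu>) {0<..}"
      by (subst (asm) has_integral_spike_set_eq[where T="{0<..}"])
         (auto intro!: negligible_subset[OF negligible_sing[of 0]])
    moreover have "(LBINT v:{0<..}. gig_kernel \<mu> 1 0 v) = integral {0<..} (gig_kernel \<mu> 1 0)"
      using \<mu> by (intro set_borel_integral_eq_integral gig_integrable_Gamma) auto
    ultimately show ?thesis by (simp add: integral_unique)
  qed
  let ?C = "LBINT v:{0<..}. gig_kernel (\<mu> - 1) 1 0 v"
  have I0: "set_integrable lborel {0<..} (gig_kernel \<mu> 1 0)"
    "set_integrable lborel {0<..} (gig_kernel (\<mu> - 1) 1 0)"
    using \<mu> by (auto intro!: gig_integrable_Gamma)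
  show "\<forall>\<^sub>F q in at_right 0. norm (gig_integral \<mu> 1 q - Gamma \<mu>) \<le> q * ?C"
    unfolding eventually_at_filter
  proof (intro always_eventually allI impI)
    fix q :: real assume "q \<in> {0<..}"
    then have q: "q > 0" by simp
    note Iq = gig_integrable[of 1 q \<mu>]
    have b: "0 \<le> gig_kernel \<mu> 1 0 v - gig_kernel \<mu> 1 q v \<and>
        gig_kernel \<mu> 1 0 v - gig_kernel \<mu> 1 q v \<le> q * gig_kernel (\<mu> - 1) 1 0 v" if v: "v > 0" for v
    proof -
      have "gig_kernel \<mu> 1 0 v - gig_kernel \<mu> 1 q v = gig_kernel \<mu> 1 0 v * (1 - exp (- (q / v)))"
        by (simp add: gig_kernel_def exp_diff exp_minus field_simps)
      moreover have "0 \<le> 1 - exp (- (q / v))" "1 - exp (- (q / v)) \<le> q / v"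
        using q v exp_ge_add_one_self[of "- (q / v)"] by auto
      moreover have "q * gig_kernel (\<mu> - 1) 1 0 v = gig_kernel \<mu> 1 0 v * (q / v)"
        by (simp add: gig_kernel_lower[OF v])
      ultimately show ?thesis
        using gig_kernel_nonneg[of \<mu> 1 0 v] by (simp only: mult_left_mono mult_nonneg_nonneg simp_thms)
    qed
    have "Gamma \<mu> - gig_integral \<mu> 1 q = (LBINT v:{0<..}. gig_kernel \<mu> 1 0 v - gig_kernel \<mu> 1 q v)"
      unfolding G[symmetric] gig_integral_def using q by (intro set_integral_diff(2)[symmetric] I0 Iq) auto
    moreover have "\<dots> \<le> (LBINT v:{0<..}. q * gig_kernel (\<mu> - 1) 1 0 v)"
      using b q by (intro set_integral_mono set_integral_diff I0 Iq set_integrable_mult_right) auto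
    moreover have "0 \<le> (LBINT v:{0<..}. gig_kernel \<mu> 1 0 v - gig_kernel \<mu> 1 q v)"
      using b unfolding set_lebesgue_integral_def
      by (intro Bochner_Integration.integral_nonneg) (auto split: split_indicator)
    ultimately show "norm (gig_integral \<mu> 1 q - Gamma \<mu>) \<le> q * ?C"
      by simp
  qed
  show "((\<lambda>q. q * ?C) \<longlongrightarrow> 0) (at_right 0)"
    by (auto intro!: tendsto_eq_intros)
qed


section \<open>The Wronskian of the Bessel functions\<close>

text \<open>
Up to the factor \<open>z powr (\<nu> + 1)\<close> this is the Wronskian of the two solutions \<open>bessel_series \<nu>\<close> and
\<open>gig_integral (- \<nu>) 1\<close> of one and the same equation; by the shift rules the derivatives of the two are
\<open>bessel_series (\<nu> + 1)\<close> and \<open>- gig_integral (- \<nu> - 1) 1\<close>.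
\<close>

definition wronskian_form :: "real \<Rightarrow> real \<Rightarrow> real" where
  "wronskian_form \<nu> z = z powr (\<nu> + 1) *
     (bessel_series \<nu> z * gig_integral (- \<nu> - 1) 1 z + bessel_series (\<nu> + 1) z * gig_integral (- \<nu>) 1 z)"

lemma gig_recurrence_order:
  assumes "z > 0"
  shows "z * gig_integral (- \<nu> - 2) 1 z = gig_integral (- \<nu>) 1 z + (\<nu> + 1) * gig_integral (- \<nu> - 1) 1 z"
  using gig_integral_recurrence[of 1 z "- \<nu> - 1"] assms by (simp add: algebra_simps)

lemma wronskian_form_has_derivative:
  assumes z: "z > 0"
  shows "(wronskian_form \<nu> has_real_derivative 0) (at z)"
proof -
  let ?E0 = "bessel_series \<nu> z" and ?E1 = "bessel_series (\<nu> + 1) z" and ?E2 = "bessel_series (\<nu> + 2) z"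
  let ?M0 = "gig_integral (- \<nu>) 1 z" and ?M1 = "gig_integral (- \<nu> - 1) 1 z" and ?M2 = "gig_integral (- \<nu> - 2) 1 z"
  have dE: "(bessel_series \<nu> has_real_derivative ?E1) (at z)"
    "(bessel_series (\<nu> + 1) has_real_derivative ?E2) (at z)"
    using bessel_series_has_derivative[of \<nu> z] bessel_series_has_derivative[of "\<nu> + 1" z]
    by (simp_all add: add.assoc)
  have dM: "(gig_integral (- \<nu>) 1 has_real_derivative - ?M1) (at z)"
    "(gig_integral (- \<nu> - 1) 1 has_real_derivative - ?M2) (at z)"
    using gig_integral_has_derivative[of 1 z "- \<nu>"] gig_integral_has_derivative[of 1 z "- \<nu> - 1"] z
    by (simp_all add: diff_diff_eq)
  have "(wronskian_form \<nu> has_real_derivative (\<nu> + 1) * z powr \<nu> * (?E0 * ?M1 + ?E1 * ?M0)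
      + z powr (\<nu> + 1) * (?E2 * ?M0 - ?E0 * ?M2)) (at z)"
  proof -
    have "((\<lambda>z. z powr (\<nu> + 1)) has_real_derivative (\<nu> + 1) * z powr \<nu>) (at z)"
      using has_real_derivative_powr[OF z, of "\<nu> + 1"] by simp
    from DERIV_mult[OF this DERIV_add[OF DERIV_mult[OF dE(1) dM(2)] DERIV_mult[OF dE(2) dM(1)]]]
    show ?thesis
      unfolding wronskian_form_def[abs_def] by (rule DERIV_cong) (simp add: algebra_simps)
  qed
  moreover have "z powr (\<nu> + 1) * (?E2 * ?M0 - ?E0 * ?M2) = z powr \<nu> * ((z * ?E2) * ?M0 - ?E0 * (z * ?M2))"
    using z by (simp add: powr_add algebra_simps)
  moreover have "z * ?E2 = ?E0 - (\<nu> + 1) * ?E1"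
    using bessel_series_recurrence[of \<nu> z] by simp
  ultimately show ?thesis
    using gig_recurrence_order[OF z, of \<nu>] by (simp add: algebra_simps)
qed

lemma wronskian_form_shift:
  assumes z: "z > 0"
  shows "wronskian_form (\<nu> + 1) z = wronskian_form \<nu> z"
proof -
  let ?E0 = "bessel_series \<nu> z" and ?E1 = "bessel_series (\<nu> + 1) z" and ?E2 = "bessel_series (\<nu> + 2) z"
  let ?M0 = "gig_integral (- \<nu>) 1 z" and ?M1 = "gig_integral (- \<nu> - 1) 1 z" and ?M2 = "gig_integral (- \<nu> - 2) 1 z"
  have "wronskian_form (\<nu> + 1) z = z powr (\<nu> + 2) * (?E1 * ?M2 + ?E2 * ?M1)"
  proof -
    have "- (\<nu> + 1) = - \<nu> - 1" "- (\<nu> + 1) - 1 = - \<nu> - 2" "\<nu> + 1 + 1 = \<nu> + 2" by simp_all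
    then show ?thesis unfolding wronskian_form_def by metis
  qed
  also have "\<dots> = z powr (\<nu> + 1) * (?E1 * (z * ?M2) + (z * ?E2) * ?M1)"
    using z powr_add[of z "\<nu> + 1" 1] by (simp add: algebra_simps)
  also have "z * ?E2 = ?E0 - (\<nu> + 1) * ?E1"
    using bessel_series_recurrence[of \<nu> z] by simp
  also have "z * ?M2 = ?M0 + (\<nu> + 1) * ?M1"
    using gig_recurrence_order[OF z] .
  finally show ?thesis by (simp add: wronskian_form_def algebra_simps)
qed

text \<open>
The classical identity \<open>I\<^sub>\<nu>(x) * K\<^bsub>\<nu>+1\<^esub>(x) + I\<^bsub>\<nu>+1\<^esub>(x) * K\<^sub>\<nu>(x) = 1 / x\<close> for every real order. The left-hand side
below is constant in \<open>z\<close> and invariant under \<open>\<nu> \<mapsto> \<nu> + 1\<close>. For large \<open>\<nu>\<close> it can be read off in the limit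
\<open>z \<rightarrow> 0\<close>, where the first summand tends to \<open>\<Gamma>(\<nu> + 1) / \<Gamma>(\<nu> + 1)\<close> and the second one vanishes; for small
orders a direct limit would have to deal with the poles of the Gamma function.
\<close>

lemma wronskian_form_eq_1:
  assumes z: "z > 0"
  shows "wronskian_form \<nu> z = 1"
proof -
  \<comment> \<open>after the shift the order exceeds 1, as the limit of gig_integral at zero requires\<close>
  obtain n :: nat where n: "real n > 1 - \<nu>" using reals_Archimedean2 by blast
  define \<nu>' where "\<nu>' = \<nu> + real n"
  have \<nu>': "\<nu>' > 1" using n by (simp add: \<nu>'_def)
  have shift: "wronskian_form (\<nu> + real k) z = wronskian_form \<nu> z" for k
  proof (induction k)
    case (Suc k)
    then show ?case using wronskian_form_shift[OF z, of "\<nu> + real k"] by (simp add: add_ac)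
  qed simp
  have "\<exists>c. \<forall>x\<in>{0<..}. wronskian_form \<nu>' x = c"
    by (rule has_field_derivative_zero_constant)
       (auto intro: has_field_derivative_at_within wronskian_form_has_derivative)
  then have const: "wronskian_form \<nu>' y = wronskian_form \<nu>' z" if "y > 0" for y
    using that z by auto
  have eq: "wronskian_form \<nu>' y = bessel_series \<nu>' y * gig_integral (\<nu>' + 1) 1 y
      + y * bessel_series (\<nu>' + 1) y * gig_integral \<nu>' 1 y" if y: "y > 0" for y
  proof -
    have "- (\<nu>' + 1) = - \<nu>' - 1" by simp
    then have "gig_integral (\<nu>' + 1) 1 y = y powr (\<nu>' + 1) * gig_integral (- \<nu>' - 1) 1 y"
      using gig_integral_uminus[OF y, of "\<nu>' + 1"] by metis
    then show ?thesis
      using gig_integral_uminus[OF y, of \<nu>'] y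
      by (simp add: wronskian_form_def powr_add distrib_left)
  qed
  have cE: "(bessel_series \<mu> \<longlongrightarrow> bessel_series \<mu> 0) (at_right 0)" for \<mu>
    using DERIV_isCont[OF bessel_series_has_derivative[of \<mu> 0]]
    by (auto simp: isCont_def intro: filterlim_at_within_not_equal tendsto_within_subset)
  have E0: "bessel_series \<nu>' 0 = rGamma (\<nu>' + 1)"
    unfolding bessel_series_def by (subst powser_zero) simp
  have "((\<lambda>y. bessel_series \<nu>' y * gig_integral (\<nu>' + 1) 1 y + y * bessel_series (\<nu>' + 1) y * gig_integral \<nu>' 1 y)
     \<longlongrightarrow> bessel_series \<nu>' 0 * Gamma (\<nu>' + 1) + 0 * bessel_series (\<nu>' + 1) 0 * Gamma \<nu>') (at_right 0)"
    using \<nu>' by (intro tendsto_intros cE gig_integral_tendsto_Gamma) auto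
  moreover have "bessel_series \<nu>' 0 * Gamma (\<nu>' + 1) = 1"
    unfolding E0 rGamma_inverse_Gamma using \<nu>' Gamma_real_pos[of "\<nu>' + 1"]
    by (intro left_inverse) linarith
  ultimately have "(wronskian_form \<nu>' \<longlongrightarrow> 1) (at_right 0)"
    by (subst (asm) tendsto_cong[of _ "wronskian_form \<nu>'"])
       (auto simp: eventually_at_filter eq)
  moreover have "(wronskian_form \<nu>' \<longlongrightarrow> wronskian_form \<nu>' z) (at_right 0)"
    using const by (intro tendsto_eventually) (auto simp: eventually_at_filter)
  ultimately have "wronskian_form \<nu>' z = 1"
    using tendsto_unique[OF trivial_limit_at_right_real] by blast
  then show ?thesis using shift[of n] by (simp add: \<nu>'_def)
qed

section \<open>Normalisation of the generalized hyperbolic density\<close>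

lemma gaussian_integral:
  fixes a b :: real
  assumes a: "a > 0"
  shows "(\<integral>\<^sup>+x. ennreal (exp (b * x - a * x\<^sup>2)) \<partial>lborel) = ennreal (sqrt (pi / a) * exp (b\<^sup>2 / (4 * a)))"
proof -
  define \<sigma> where "\<sigma> = 1 / sqrt (2 * a)"
  have \<sigma>: "\<sigma> > 0" "\<sigma>\<^sup>2 = 1 / (2 * a)" using a by (simp_all add: \<sigma>_def power_divide)
  define C where "C = sqrt (pi / a) * exp (b\<^sup>2 / (4 * a))"
  have eq: "exp (b * x - a * x\<^sup>2) = C * normal_density (b / (2 * a)) \<sigma> x" for x
  proof -
    have "b * x - a * x\<^sup>2 = b\<^sup>2 / (4 * a) - a * (x - b / (2 * a))\<^sup>2"
      using a by (simp add: field_simps power2_eq_square)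
    then have "exp (b * x - a * x\<^sup>2) = exp (b\<^sup>2 / (4 * a)) * exp (- (a * (x - b / (2 * a))\<^sup>2))"
      by (simp flip: exp_add)
    moreover have "normal_density (b / (2 * a)) \<sigma> x = 1 / sqrt (pi / a) * exp (- (a * (x - b / (2 * a))\<^sup>2))"
      unfolding normal_density_def \<sigma>(2) using a by (simp add: field_simps)
    ultimately show ?thesis using a by (simp add: C_def)
  qed
  have "(\<integral>\<^sup>+x. ennreal (exp (b * x - a * x\<^sup>2)) \<partial>lborel)
      = (\<integral>\<^sup>+x. ennreal C * ennreal (normal_density (b / (2 * a)) \<sigma> x) \<partial>lborel)"
    unfolding eq using a by (simp add: C_def ennreal_mult)
  also have "\<dots> = ennreal C * (\<integral>\<^sup>+x. ennreal (normal_density (b / (2 * a)) \<sigma> x) \<partial>lborel)"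
    by (rule nn_integral_cmult) measurable
  also have "(\<integral>\<^sup>+x. ennreal (normal_density (b / (2 * a)) \<sigma> x) \<partial>lborel) = 1"
    using nn_integral_eq_integral[OF integrable_normal_density[OF \<sigma>(1)], of "b / (2 * a)"]
      integral_normal_density[OF \<sigma>(1)] by simp
  finally show ?thesis by (simp add: C_def)
qed

lemma nn_integral_gig:
  assumes "p > 0" "q > 0"
  shows "(\<integral>\<^sup>+v. ennreal (indicator {0<..} v * gig_kernel \<mu> p q v) \<partial>lborel) = ennreal (gig_integral \<mu> p q)"
  using nn_integral_eq_integral[OF gig_integrable[OF assms, unfolded set_integrable_def], of \<mu>]
  by (simp add: gig_kernel_nonneg gig_integral_def set_lebesgue_integral_def)

text \<open>
The generalized hyperbolic law is a Gaussian mixture over a generalized inverse Gaussian mixing variable \<open>v\<close>.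
By Tonelli the integration over \<open>x\<close> comes first; it contributes \<open>sqrt (4 * pi * v) / \<alpha> * exp (\<beta>\<^sup>2 * v / \<alpha>\<^sup>2)\<close>,
which raises the order by one half and changes the rate of \<open>v\<close> from \<open>1\<close> to \<open>(\<alpha>\<^sup>2 - \<beta>\<^sup>2) / \<alpha>\<^sup>2\<close>.
\<close>

lemma integral_exp_gig:
  fixes \<alpha> \<beta> \<delta> \<nu> :: real
  assumes \<delta>: "\<delta> > 0" and \<alpha>: "\<alpha> > \<bar>\<beta>\<bar>"
  shows "(\<integral>\<^sup>+x. ennreal (exp (\<beta> * x) * gig_integral \<nu> 1 (\<alpha>\<^sup>2 * (\<delta>\<^sup>2 + x\<^sup>2) / 4)) \<partial>lborel)
    = ennreal (2 * sqrt pi / \<alpha> * gig_integral (\<nu> + 1/2) ((\<alpha>\<^sup>2 - \<beta>\<^sup>2) / \<alpha>\<^sup>2) (\<alpha>\<^sup>2 * \<delta>\<^sup>2 / 4))"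
proof -
  let ?z = "\<lambda>x. \<alpha>\<^sup>2 * (\<delta>\<^sup>2 + x\<^sup>2) / 4"
  let ?p = "(\<alpha>\<^sup>2 - \<beta>\<^sup>2) / \<alpha>\<^sup>2" and ?q = "\<alpha>\<^sup>2 * \<delta>\<^sup>2 / 4"
  have a0: "\<alpha> > 0" using \<alpha> by linarith
  have z: "?z x > 0" for x
    using a0 \<delta> by (intro divide_pos_pos mult_pos_pos add_pos_nonneg) auto
  have p: "?p > 0" using \<alpha> a0 by (simp add: abs_square_less_1 power2_strict_mono abs_less_iff power_strict_mono[of "\<bar>\<beta>\<bar>" \<alpha> 2, simplified])
  have q: "?q > 0" using a0 \<delta> by simp
  have "(\<integral>\<^sup>+x. ennreal (exp (\<beta> * x) * gig_integral \<nu> 1 (?z x)) \<partial>lborel)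
     = (\<integral>\<^sup>+x. (\<integral>\<^sup>+v. ennreal (exp (\<beta> * x)) * ennreal (indicator {0<..} v * gig_kernel \<nu> 1 (?z x) v) \<partial>lborel) \<partial>lborel)"
    using z by (simp add: nn_integral_cmult nn_integral_gig ennreal_mult gig_integral_pos less_imp_le)
  also have "\<dots> = (\<integral>\<^sup>+v. (\<integral>\<^sup>+x. ennreal (exp (\<beta> * x)) * ennreal (indicator {0<..} v * gig_kernel \<nu> 1 (?z x) v) \<partial>lborel) \<partial>lborel)"
    by (rule lborel_pair.Fubini'[symmetric]) (unfold gig_kernel_def, measurable)
  also have "\<dots> = (\<integral>\<^sup>+v. ennreal (2 * sqrt pi / \<alpha>) * ennreal (indicator {0<..} v * gig_kernel (\<nu> + 1/2) ?p ?q v) \<partial>lborel)"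
  proof (intro nn_integral_cong)
    fix v :: real
    show "(\<integral>\<^sup>+x. ennreal (exp (\<beta> * x)) * ennreal (indicator {0<..} v * gig_kernel \<nu> 1 (?z x) v) \<partial>lborel)
      = ennreal (2 * sqrt pi / \<alpha>) * ennreal (indicator {0<..} v * gig_kernel (\<nu> + 1/2) ?p ?q v)"
    proof (cases "v > 0")
      case True
      \<comment> \<open>the part of the integrand that does not depend on x\<close>
      define c where "c = v powr (\<nu> - 1) * exp (- v - ?q / v)"
      have c: "c \<ge> 0" by (simp add: c_def)
      have e: "exp (\<beta> * x) * gig_kernel \<nu> 1 (?z x) v = c * exp (\<beta> * x - \<alpha>\<^sup>2 / (4 * v) * x\<^sup>2)" for x
      proof -
        have "\<beta> * x + (- (1 * v) - ?z x / v) = (- v - ?q / v) + (\<beta> * x - \<alpha>\<^sup>2 / (4 * v) * x\<^sup>2)"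
          using True by (simp add: field_simps)
        then have "exp (\<beta> * x) * exp (- (1 * v) - ?z x / v) = exp (- v - ?q / v) * exp (\<beta> * x - \<alpha>\<^sup>2 / (4 * v) * x\<^sup>2)"
          by (simp only: flip: exp_add)
        then show ?thesis by (simp add: gig_kernel_def c_def mult_ac)
      qed
      have "(\<integral>\<^sup>+x. ennreal (exp (\<beta> * x)) * ennreal (indicator {0<..} v * gig_kernel \<nu> 1 (?z x) v) \<partial>lborel)
        = (\<integral>\<^sup>+x. ennreal c * ennreal (exp (\<beta> * x - \<alpha>\<^sup>2 / (4 * v) * x\<^sup>2)) \<partial>lborel)"
        using True c by (simp add: gig_kernel_nonneg e flip: ennreal_mult)
      also have "\<dots> = ennreal c * (\<integral>\<^sup>+x. ennreal (exp (\<beta> * x - \<alpha>\<^sup>2 / (4 * v) * x\<^sup>2)) \<partial>lborel)"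
        by (rule nn_integral_cmult) measurable
      also have "\<dots> = ennreal (c * (sqrt (pi / (\<alpha>\<^sup>2 / (4 * v))) * exp (\<beta>\<^sup>2 / (4 * (\<alpha>\<^sup>2 / (4 * v))))))"
        using True a0 c by (subst gaussian_integral) (auto simp: ennreal_mult)
      also have "c * (sqrt (pi / (\<alpha>\<^sup>2 / (4 * v))) * exp (\<beta>\<^sup>2 / (4 * (\<alpha>\<^sup>2 / (4 * v)))))
         = 2 * sqrt pi / \<alpha> * gig_kernel (\<nu> + 1/2) ?p ?q v"
      proof -
        have "sqrt (pi / (\<alpha>\<^sup>2 / (4 * v))) = 2 * sqrt pi / \<alpha> * v powr (1/2)"
          using True a0 by (simp add: powr_half_sqrt real_sqrt_divide real_sqrt_mult)
        moreover have "exp (- v - ?q / v) * exp (\<beta>\<^sup>2 / (4 * (\<alpha>\<^sup>2 / (4 * v)))) = exp (- (?p * v) - ?q / v)"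
        proof -
          have "(- v - ?q / v) + \<beta>\<^sup>2 / (4 * (\<alpha>\<^sup>2 / (4 * v))) = - (?p * v) - ?q / v"
            using True a0 by (simp add: field_simps)
          then show ?thesis by (simp only: flip: exp_add)
        qed
        moreover have "v powr (\<nu> + 1/2 - 1) = v powr (\<nu> - 1) * v powr (1/2)"
          by (simp flip: powr_add add: algebra_simps)
        ultimately show ?thesis unfolding c_def gig_kernel_def by (simp add: mult_ac)
      qed
      also have "ennreal \<dots> = ennreal (2 * sqrt pi / \<alpha>) * ennreal (gig_kernel (\<nu> + 1/2) ?p ?q v)"
        using a0 by (intro ennreal_mult) (simp_all add: gig_kernel_nonneg)
      finally show ?thesis using True by simp
    qed simp
  qed
  also have "\<dots> = ennreal (2 * sqrt pi / \<alpha>) * ennreal (gig_integral (\<nu> + 1/2) ?p ?q)"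
    by (subst nn_integral_cmult) (auto simp: nn_integral_gig[OF p q])
  also have "\<dots> = ennreal (2 * sqrt pi / \<alpha> * gig_integral (\<nu> + 1/2) ?p ?q)"
    using a0 gig_integral_pos[OF p q] by (intro ennreal_mult[symmetric]) (simp_all add: less_imp_le)
  finally show ?thesis .
qed

lemma scaled_powr_half:
  fixes \<alpha> \<mu> R :: real
  assumes \<alpha>: "\<alpha> > 0" and R: "R > 0"
  shows "(\<alpha>\<^sup>2 * R / 4) powr (\<mu> / 2) = (\<alpha> / 2) powr \<mu> * R powr (\<mu> / 2)"
proof -
  have "(\<alpha>\<^sup>2 * R / 4) = (\<alpha> / 2) powr 2 * R"
      using \<alpha> by (simp add: power_divide)
  then have "(\<alpha>\<^sup>2 * R / 4) powr (\<mu> / 2) = ((\<alpha> / 2) powr 2) powr (\<mu> / 2) * R powr (\<mu> / 2)"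
      using \<alpha> R by (simp only: powr_mult)
  then show ?thesis by (simp add: powr_powr)
qed

text \<open>
The weight of the density and the two fundamental solutions of the Stein equation in terms of
\<open>z = \<alpha>\<^sup>2 * R / 4\<close>, where \<open>R = \<delta>\<^sup>2 + x\<^sup>2\<close>. All three become smooth functions of \<open>x\<close>, also at \<open>x = 0\<close>.
\<close>

lemma powr_bessel_K_eq_gig:
  fixes \<alpha> \<nu> R :: real
  assumes \<alpha>: "\<alpha> > 0" and R: "R > 0"
  shows "R powr (\<nu> / 2) * bessel_K \<nu> (\<alpha> * sqrt R) = gig_integral \<nu> 1 (\<alpha>\<^sup>2 * R / 4) / (2 * (\<alpha> / 2) powr \<nu>)"
    and "bessel_K \<nu> (\<alpha> * sqrt R) / R powr (\<nu> / 2) = (\<alpha> / 2) powr \<nu> / 2 * gig_integral (- \<nu>) 1 (\<alpha>\<^sup>2 * R / 4)"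
    and "bessel_I \<nu> (\<alpha> * sqrt R) / R powr (\<nu> / 2) = (\<alpha> / 2) powr \<nu> * bessel_series \<nu> (\<alpha>\<^sup>2 * R / 4)"
proof -
  have s: "2 * sqrt (1 * (\<alpha>\<^sup>2 * R / 4)) = \<alpha> * sqrt R"
    using \<alpha> by (simp add: real_sqrt_mult real_sqrt_divide)
  note w = scaled_powr_half[OF \<alpha> R]
  have K: "gig_integral \<mu> 1 (\<alpha>\<^sup>2 * R / 4) = 2 * ((\<alpha> / 2) powr \<mu> * R powr (\<mu> / 2)) * bessel_K \<mu> (\<alpha> * sqrt R)" for \<mu>
    using gig_integral_eq_bessel_K[of 1 "\<alpha>\<^sup>2 * R / 4" \<mu>] \<alpha> R unfolding s w[symmetric] by simp
  have pos: "(\<alpha> / 2) powr \<nu> > 0" "R powr (\<nu> / 2) > 0" using \<alpha> R by auto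
  show "R powr (\<nu> / 2) * bessel_K \<nu> (\<alpha> * sqrt R) = gig_integral \<nu> 1 (\<alpha>\<^sup>2 * R / 4) / (2 * (\<alpha> / 2) powr \<nu>)"
    unfolding K using pos by simp
  show "bessel_K \<nu> (\<alpha> * sqrt R) / R powr (\<nu> / 2) = (\<alpha> / 2) powr \<nu> / 2 * gig_integral (- \<nu>) 1 (\<alpha>\<^sup>2 * R / 4)"
    unfolding K bessel_K_minus using pos by (simp add: powr_minus field_simps)
  have "(\<alpha> * sqrt R / 2) powr \<nu> = (\<alpha> / 2) powr \<nu> * R powr (\<nu> / 2)"
  proof -
    have "\<alpha> * sqrt R / 2 = (\<alpha> / 2) * R powr (1/2)" using R by (simp add: powr_half_sqrt)
    then show ?thesis using \<alpha> R by (simp only: powr_mult powr_powr) simp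
  qed
  moreover have "(\<alpha> * sqrt R / 2)\<^sup>2 = \<alpha>\<^sup>2 * R / 4"
    using R by (simp add: power_divide power_mult_distrib)
  ultimately show "bessel_I \<nu> (\<alpha> * sqrt R) / R powr (\<nu> / 2) = (\<alpha> / 2) powr \<nu> * bessel_series \<nu> (\<alpha>\<^sup>2 * R / 4)"
    using bessel_I_eq_bessel_series[of "\<alpha> * sqrt R" \<nu>] \<alpha> R pos by (simp only:) simp
qed

lemma continuous_on_gig_integral:
  fixes \<alpha> \<delta> \<mu> :: real
  assumes "\<alpha> > 0" "\<delta> > 0"
  shows "continuous_on A (\<lambda>x. gig_integral \<mu> 1 (\<alpha>\<^sup>2 * (\<delta>\<^sup>2 + x\<^sup>2) / 4))"
proof (rule continuous_at_imp_continuous_on, rule ballI)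
  fix x
  have "\<alpha>\<^sup>2 * (\<delta>\<^sup>2 + x\<^sup>2) / 4 > 0"
    using assms by (intro divide_pos_pos mult_pos_pos add_pos_nonneg) auto
  then have "isCont (gig_integral \<mu> 1) (\<alpha>\<^sup>2 * (\<delta>\<^sup>2 + x\<^sup>2) / 4)"
    by (intro DERIV_isCont[OF gig_integral_has_derivative]) auto
  then show "isCont (\<lambda>x. gig_integral \<mu> 1 (\<alpha>\<^sup>2 * (\<delta>\<^sup>2 + x\<^sup>2) / 4)) x"
    by (rule isCont_o2[rotated]) (intro continuous_intros, simp)
qed

text \<open>
The normalising constant is needed exactly: only because the density has mass one does the weighted function
\<open>h - E h(X)\<close> integrate to zero, and this is what makes the two formulas for the solution agree.
\<close>

lemma gh_density_total_mass:
  fixes \<alpha> \<beta> \<delta> l :: real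
  assumes \<delta>: "\<delta> > 0" and \<alpha>: "\<alpha> > \<bar>\<beta>\<bar>"
  shows "(\<integral>\<^sup>+x. ennreal (gh_density l \<alpha> \<beta> \<delta> x) \<partial>lborel) = 1"
proof -
  define g where "g = \<alpha>\<^sup>2 - \<beta>\<^sup>2"
  have a0: "\<alpha> > 0" using \<alpha> by linarith
  have g: "g > 0" using \<alpha> power_strict_mono[of "\<bar>\<beta>\<bar>" \<alpha> 2] by (simp add: g_def)
  define \<nu> where "\<nu> = l - 1/2"
  define K where "K = bessel_K l (\<delta> * sqrt g)"
  have K: "K > 0" using \<delta> g by (simp add: K_def bessel_K_pos)
  define N where "N = g powr (l / 2) / (sqrt (2 * pi) * \<alpha> powr \<nu> * \<delta> powr l * K) / (2 * (\<alpha> / 2) powr \<nu>)"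
  have N: "N > 0" using a0 g \<delta> K by (simp add: N_def)
  have d: "gh_density l \<alpha> \<beta> \<delta> x = N * (exp (\<beta> * x) * gig_integral \<nu> 1 (\<alpha>\<^sup>2 * (\<delta>\<^sup>2 + x\<^sup>2) / 4))" for x
  proof -
    have "\<delta>\<^sup>2 + x\<^sup>2 > 0" using \<delta> by (intro add_pos_nonneg) auto
    from powr_bessel_K_eq_gig(1)[OF a0 this, of \<nu>] show ?thesis
      unfolding gh_density_def N_def K_def g_def \<nu>_def by (simp add: mult_ac)
  qed
  have "(\<integral>\<^sup>+x. ennreal (gh_density l \<alpha> \<beta> \<delta> x) \<partial>lborel)
    = ennreal N * (\<integral>\<^sup>+x. ennreal (exp (\<beta> * x) * gig_integral \<nu> 1 (\<alpha>\<^sup>2 * (\<delta>\<^sup>2 + x\<^sup>2) / 4)) \<partial>lborel)"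
  proof -
    have "continuous_on UNIV (\<lambda>x. exp (\<beta> * x) * gig_integral \<nu> 1 (\<alpha>\<^sup>2 * (\<delta>\<^sup>2 + x\<^sup>2) / 4))"
      by (intro continuous_intros continuous_on_gig_integral a0 \<delta>)
    then have [measurable]: "(\<lambda>x. exp (\<beta> * x) * gig_integral \<nu> 1 (\<alpha>\<^sup>2 * (\<delta>\<^sup>2 + x\<^sup>2) / 4)) \<in> borel_measurable borel"
      by (rule borel_measurable_continuous_onI)
    have "ennreal (gh_density l \<alpha> \<beta> \<delta> x)
        = ennreal N * ennreal (exp (\<beta> * x) * gig_integral \<nu> 1 (\<alpha>\<^sup>2 * (\<delta>\<^sup>2 + x\<^sup>2) / 4))" for x
      unfolding d using N by (intro ennreal_mult') simp
    then show ?thesis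
      by (simp only:) (rule nn_integral_cmult, measurable)
  qed
  also have "\<dots> = ennreal (N * (2 * sqrt pi / \<alpha> * gig_integral (\<nu> + 1/2) (g / \<alpha>\<^sup>2) (\<alpha>\<^sup>2 * \<delta>\<^sup>2 / 4)))"
    using N unfolding integral_exp_gig[OF \<delta> \<alpha>] g_def by (intro ennreal_mult'[symmetric]) simp
  also have "N * (2 * sqrt pi / \<alpha> * gig_integral (\<nu> + 1/2) (g / \<alpha>\<^sup>2) (\<alpha>\<^sup>2 * \<delta>\<^sup>2 / 4)) = 1"
  proof -
    have s: "2 * sqrt (g / \<alpha>\<^sup>2 * (\<alpha>\<^sup>2 * \<delta>\<^sup>2 / 4)) = \<delta> * sqrt g"
      using a0 \<delta> by (simp add: real_sqrt_mult real_sqrt_divide)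
    have r: "(\<alpha>\<^sup>2 * \<delta>\<^sup>2 / 4) / (g / \<alpha>\<^sup>2) = (\<alpha> powr 4 * \<delta> powr 2) * inverse (2 powr 2 * g)"
      using a0 \<delta> g by (simp add: field_simps power2_eq_square power4_eq_xxxx)
    have q: "((\<alpha>\<^sup>2 * \<delta>\<^sup>2 / 4) / (g / \<alpha>\<^sup>2)) powr (l / 2)
        = \<alpha> powr \<nu> * \<alpha> powr \<nu> * \<alpha> * \<delta> powr l / (2 powr \<nu> * sqrt 2 * g powr (l / 2))"
    proof -
      have "\<alpha> powr (2 * l) = \<alpha> powr (\<nu> + \<nu> + 1)"
        by (simp add: \<nu>_def)
      also have "\<dots> = \<alpha> powr \<nu> * \<alpha> powr \<nu> * \<alpha>"
        using a0 by (simp only: powr_add powr_one)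
      finally have al: "\<alpha> powr (2 * l) = \<alpha> powr \<nu> * \<alpha> powr \<nu> * \<alpha>" .
      have "(2::real) powr l = 2 powr (\<nu> + 1/2)" by (simp add: \<nu>_def)
      also have "\<dots> = 2 powr \<nu> * sqrt 2" by (simp only: powr_add powr_half_sqrt)
      finally have two: "(2::real) powr l = 2 powr \<nu> * sqrt 2" .
      have "((\<alpha> powr 4 * \<delta> powr 2) * inverse (2 powr 2 * g)) powr (l / 2)
        = (\<alpha> powr 4) powr (l / 2) * (\<delta> powr 2) powr (l / 2) * inverse ((2 powr 2) powr (l / 2) * g powr (l / 2))"
        by (simp only: powr_mult inverse_powr)
      also have "\<dots> = \<alpha> powr (2 * l) * \<delta> powr l * inverse (2 powr l * g powr (l / 2))"
      proof -
        have e: "4 * (l / 2) = 2 * l" "2 * (l / 2) = l" by simp_all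
        show ?thesis by (simp only: powr_powr e)
      qed
      finally show ?thesis unfolding r al two by (simp only: divide_inverse)
    qed
    have mass: "gig_integral (\<nu> + 1/2) (g / \<alpha>\<^sup>2) (\<alpha>\<^sup>2 * \<delta>\<^sup>2 / 4)
        = 2 * ((\<alpha>\<^sup>2 * \<delta>\<^sup>2 / 4) / (g / \<alpha>\<^sup>2)) powr (l / 2) * K"
      using gig_integral_eq_bessel_K[of "g / \<alpha>\<^sup>2" "\<alpha>\<^sup>2 * \<delta>\<^sup>2 / 4" l] a0 g \<delta>
      unfolding s K_def by (simp add: \<nu>_def)
    have cancel: "G / (s2 * sp * X * D * K) / (2 * (X / T)) * (2 * sp / \<alpha> * (2 * (X * X * \<alpha> * D / (T * s2 * G)) * K)) = 2 / (s2 * s2)"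
      if "G > 0" "s2 > 0" "sp > 0" "X > 0" "D > 0" "T > 0" for G s2 sp X D T :: real
    proof -
      have "G / (s2 * sp * X * D * K) / (2 * (X / T)) = G * T / (2 * s2 * sp * X * X * D * K)"
        by simp
      moreover have "2 * sp / \<alpha> * (2 * (X * X * \<alpha> * D / (T * s2 * G)) * K) = 4 * sp * X * X * D * K / (T * s2 * G)"
        using a0 by simp
      moreover have "G * T / (2 * s2 * sp * X * X * D * K) * (4 * sp * X * X * D * K / (T * s2 * G)) = 2 / (s2 * s2)"
        using that K by simp
      ultimately show ?thesis by (simp only:)
    qed
    have N_eq: "N = g powr (l / 2) / (sqrt 2 * sqrt pi * \<alpha> powr \<nu> * \<delta> powr l * K) / (2 * (\<alpha> powr \<nu> / 2 powr \<nu>))"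
      unfolding N_def real_sqrt_mult powr_divide ..
    have "N * (2 * sqrt pi / \<alpha> * gig_integral (\<nu> + 1/2) (g / \<alpha>\<^sup>2) (\<alpha>\<^sup>2 * \<delta>\<^sup>2 / 4)) = 2 / (sqrt 2 * sqrt 2)"
      unfolding mass q N_eq using a0 g \<delta> by (intro cancel) auto
    then show ?thesis by simp
  qed
  finally show ?thesis by simp
qed

lemma gh_density_eq:
  fixes \<alpha> \<beta> \<delta> l :: real
  assumes \<delta>: "\<delta> > 0" and \<alpha>: "\<alpha> > \<bar>\<beta>\<bar>"
  obtains N where "N > 0"
    "\<And>x. gh_density l \<alpha> \<beta> \<delta> x = N * (exp (\<beta> * x) * (\<delta>\<^sup>2 + x\<^sup>2) powr ((l - 1/2) / 2) * bessel_K (l - 1/2) (\<alpha> * sqrt (\<delta>\<^sup>2 + x\<^sup>2)))"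
proof -
  have g: "\<alpha>\<^sup>2 - \<beta>\<^sup>2 > 0" "\<alpha> > 0" using \<alpha> power_strict_mono[of "\<bar>\<beta>\<bar>" \<alpha> 2] by auto
  then have "bessel_K l (\<delta> * sqrt (\<alpha>\<^sup>2 - \<beta>\<^sup>2)) > 0" using \<delta> by (intro bessel_K_pos) auto
  then have "(\<alpha>\<^sup>2 - \<beta>\<^sup>2) powr (l / 2) /
       (sqrt (2 * pi) * \<alpha> powr (l - 1 / 2) * \<delta> powr l * bessel_K l (\<delta> * sqrt (\<alpha>\<^sup>2 - \<beta>\<^sup>2))) > 0"
    using g \<delta> by (intro divide_pos_pos mult_pos_pos) auto
  then show ?thesis by (rule that) (simp add: gh_density_def)
qed

text \<open>
The weight \<open>w\<close> is the density up to a constant factor, so \<open>w * (h - E h(X))\<close> inherits integrability from \<open>h\<close>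
and has integral zero.
\<close>

lemma gh_weight_centred:
  fixes \<alpha> \<beta> \<delta> l :: real and h w :: "real \<Rightarrow> real"
  assumes w_def: "w = (\<lambda>x. exp (\<beta> * x) * (\<delta>\<^sup>2 + x\<^sup>2) powr ((l - 1/2) / 2) * bessel_K (l - 1/2) (\<alpha> * sqrt (\<delta>\<^sup>2 + x\<^sup>2)))"
    and \<delta>: "\<delta> > 0" and \<alpha>: "\<alpha> > \<bar>\<beta>\<bar>"
    and h: "h \<in> borel_measurable borel" "integrable (gh_distribution l \<alpha> \<beta> \<delta>) h"
    and w: "continuous_on UNIV w" "\<And>x. w x > 0"
  shows "integrable lborel (\<lambda>x. w x * (h x - gh_expectation l \<alpha> \<beta> \<delta> h))"
    and "(\<integral>x. w x * (h x - gh_expectation l \<alpha> \<beta> \<delta> h) \<partial>lborel) = 0"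
proof -
  obtain N where N: "N > 0" and d: "\<And>x. gh_density l \<alpha> \<beta> \<delta> x = N * w x"
    using gh_density_eq[OF \<delta> \<alpha>, of l] unfolding w_def by blast
  let ?d = "gh_density l \<alpha> \<beta> \<delta>" and ?E = "gh_expectation l \<alpha> \<beta> \<delta> h"
  have [measurable]: "w \<in> borel_measurable borel"
    using w(1) by (rule borel_measurable_continuous_onI)
  have [measurable]: "?d \<in> borel_measurable borel"
    unfolding d[abs_def] by measurable
  note [measurable] = h(1)
  have nn: "?d x \<ge> 0" for x
    using N w(2)[of x] by (simp add: d less_imp_le)
  have di: "integrable lborel ?d"
    by (rule integrableI_nonneg) (use nn gh_density_total_mass[OF \<delta> \<alpha>] in auto)
  have d1: "integral\<^sup>L lborel ?d = 1"
    using gh_density_total_mass[OF \<delta> \<alpha>, of l] nn by (subst integral_eq_nn_integral) auto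
  have dh: "integrable lborel (\<lambda>x. ?d x * h x)"
    using h(2) unfolding gh_distribution_def by (subst (asm) integrable_real_density) (use nn in auto)
  have E: "?E = (\<integral>x. ?d x * h x \<partial>lborel)"
    unfolding gh_expectation_def gh_distribution_def by (subst integral_real_density) (use nn in auto)
  have eq: "w x * (h x - ?E) = (?d x * h x - ?d x * ?E) / N" for x
    using N by (simp add: d field_simps)
  show "integrable lborel (\<lambda>x. w x * (h x - ?E))"
    unfolding eq using dh di by auto
  show "(\<integral>x. w x * (h x - ?E) \<partial>lborel) = 0"
    unfolding eq using dh di by (simp add: d1 E[symmetric])
qed


section \<open>Fundamental solutions of the homogeneous Stein equation\<close>

text \<open>
The algebraic core of the homogeneous equation. \<open>Y0\<close>, \<open>Y1\<close>, \<open>Y2\<close> stand for a solution of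
\<open>z * y'' + (l + 1/2) * y' = y\<close> and its derivatives at \<open>z = \<alpha>\<^sup>2 * (\<delta>\<^sup>2 + x\<^sup>2) / 4\<close>, and \<open>E\<close> for \<open>exp (- \<beta> * x)\<close>; the
expressions multiplied by \<open>E\<close> are the coefficients of the second derivative, the first derivative and the value of the
product \<open>exp (- \<beta> * x) * y z\<close>.
\<close>

lemma stein_operator_annihilates_profile:
  fixes x \<alpha> \<beta> \<delta> l E Y0 Y1 Y2 :: real
  assumes x: "x \<noteq> 0"
    and Y0: "Y0 = \<alpha>\<^sup>2 * (\<delta>\<^sup>2 + x\<^sup>2) / 4 * Y2 + (l + 1/2) * Y1"
  shows "(x\<^sup>2 + \<delta>\<^sup>2) / x * (E * (\<beta>\<^sup>2 * Y0 + (\<alpha>\<^sup>2 / 2 - \<beta> * \<alpha>\<^sup>2 * x) * Y1 + (\<alpha>\<^sup>2 * x / 2)\<^sup>2 * Y2))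
     + (2 * l + 2 * \<beta> * x + 2 * \<beta> * \<delta>\<^sup>2 / x - \<delta>\<^sup>2 / x\<^sup>2) * (E * (\<alpha>\<^sup>2 * x / 2 * Y1 - \<beta> * Y0))
     + (2 * l * \<beta> - (\<alpha>\<^sup>2 - \<beta>\<^sup>2) * x + \<beta>\<^sup>2 * \<delta>\<^sup>2 / x - \<beta> * \<delta>\<^sup>2 / x\<^sup>2) * (E * Y0) = 0"
    (is "?a * (E * ?A2) + ?b * (E * ?A1) + ?c * (E * Y0) = 0")
proof -
  have a: "x\<^sup>2 * ?a = x * (x\<^sup>2 + \<delta>\<^sup>2)"
    using x by (simp add: power2_eq_square)
  have b: "x\<^sup>2 * ?b = 2 * l * x\<^sup>2 + 2 * \<beta> * x ^ 3 + 2 * \<beta> * \<delta>\<^sup>2 * x - \<delta>\<^sup>2"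
    using x by (simp add: field_simps power2_eq_square power3_eq_cube)
  have c: "x\<^sup>2 * ?c = 2 * l * \<beta> * x\<^sup>2 - (\<alpha>\<^sup>2 - \<beta>\<^sup>2) * x ^ 3 + \<beta>\<^sup>2 * \<delta>\<^sup>2 * x - \<beta> * \<delta>\<^sup>2"
    using x by (simp add: field_simps power2_eq_square power3_eq_cube)
  have "x\<^sup>2 * (?a * (E * ?A2) + ?b * (E * ?A1) + ?c * (E * Y0))
     = E * ((x\<^sup>2 * ?a) * ?A2 + (x\<^sup>2 * ?b) * ?A1 + (x\<^sup>2 * ?c) * Y0)"
    by (simp only: distrib_left mult.assoc mult.left_commute)
  also have "(x\<^sup>2 * ?a) * ?A2 + (x\<^sup>2 * ?b) * ?A1 + (x\<^sup>2 * ?c) * Y0 = 0"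
    unfolding a b c Y0 by (simp add: field_simps power2_eq_square power3_eq_cube)
  finally show ?thesis using x by simp
qed

text \<open>
Serves both fundamental solutions at once, since \<open>bessel_series \<nu>\<close> and
\<open>gig_integral (- \<nu>) 1\<close> with \<open>\<nu> = l - 1/2\<close> solve the same equation in \<open>z\<close>.
\<close>

lemma bessel_profile_derivatives:
  fixes \<alpha> \<beta> \<delta> l :: real and A y0 y1 y2 z :: "real \<Rightarrow> real"
  assumes z_def: "z = (\<lambda>x. \<alpha>\<^sup>2 * (\<delta>\<^sup>2 + x\<^sup>2) / 4)"
    and A: "A = (\<lambda>x. exp (- \<beta> * x) * y0 (z x))"
    and \<alpha>: "\<alpha> > 0" and \<delta>: "\<delta> > 0"
    and y0: "\<And>t. t > 0 \<Longrightarrow> (y0 has_real_derivative y1 t) (at t)"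
    and y1: "\<And>t. t > 0 \<Longrightarrow> (y1 has_real_derivative y2 t) (at t)"
    and y2: "\<And>t. t > 0 \<Longrightarrow> isCont y2 t"
    and ode: "\<And>t. t > 0 \<Longrightarrow> t * y2 t + (l + 1/2) * y1 t = y0 t"
  obtains A1 A2 where
    "\<And>x. (A has_real_derivative A1 x) (at x)"
    "\<And>x. (A1 has_real_derivative A2 x) (at x)"
    "continuous_on UNIV A2"
    "\<And>x. A1 x = exp (- \<beta> * x) * (\<alpha>\<^sup>2 * x / 2 * y1 (z x) - \<beta> * y0 (z x))"
    "\<And>x. x \<noteq> 0 \<Longrightarrow> (x\<^sup>2 + \<delta>\<^sup>2) / x * A2 x
     + (2 * l + 2 * \<beta> * x + 2 * \<beta> * \<delta>\<^sup>2 / x - \<delta>\<^sup>2 / x\<^sup>2) * A1 x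
     + (2 * l * \<beta> - (\<alpha>\<^sup>2 - \<beta>\<^sup>2) * x + \<beta>\<^sup>2 * \<delta>\<^sup>2 / x - \<beta> * \<delta>\<^sup>2 / x\<^sup>2) * A x = 0"
proof -
  have z: "z x > 0" for x
    unfolding z_def using \<alpha> \<delta> by (intro divide_pos_pos mult_pos_pos add_pos_nonneg) auto
  have dz: "(z has_real_derivative \<alpha>\<^sup>2 * x / 2) (at x)" for x
    unfolding z_def by (auto intro!: derivative_eq_intros)
  have d0: "((\<lambda>x. y0 (z x)) has_real_derivative y1 (z x) * (\<alpha>\<^sup>2 * x / 2)) (at x)" for x
    by (rule DERIV_chain2[OF y0[OF z] dz])
  have d1: "((\<lambda>x. y1 (z x)) has_real_derivative y2 (z x) * (\<alpha>\<^sup>2 * x / 2)) (at x)" for x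
    by (rule DERIV_chain2[OF y1[OF z] dz])
  define A1 where "A1 = (\<lambda>x. exp (- \<beta> * x) * (\<alpha>\<^sup>2 * x / 2 * y1 (z x) - \<beta> * y0 (z x)))"
  define A2 where "A2 = (\<lambda>x. exp (- \<beta> * x) * (\<beta>\<^sup>2 * y0 (z x) + (\<alpha>\<^sup>2 / 2 - \<beta> * \<alpha>\<^sup>2 * x) * y1 (z x)
      + (\<alpha>\<^sup>2 * x / 2)\<^sup>2 * y2 (z x)))"
  show ?thesis
  proof (rule that)
    show "(A has_real_derivative A1 x) (at x)" for x
      unfolding A A1_def by (auto intro!: derivative_eq_intros d0 simp: algebra_simps)
    show "(A1 has_real_derivative A2 x) (at x)" for x
    proof -
      \<comment> \<open>a name for the only fraction keeps the remaining identity polynomial\<close>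
      define s where "s = \<alpha>\<^sup>2 / 2"
      have s: "\<alpha>\<^sup>2 * y / 2 = s * y" for y by (simp add: s_def)
      have e: "((\<lambda>x. exp (- \<beta> * x)) has_real_derivative - \<beta> * exp (- \<beta> * x)) (at x)"
        by (auto intro!: derivative_eq_intros)
      have i: "((\<lambda>x. s * x * y1 (z x) - \<beta> * y0 (z x)) has_real_derivative
          s * y1 (z x) + s * x * (y2 (z x) * (s * x)) - \<beta> * (y1 (z x) * (s * x))) (at x)"
        by (auto intro!: derivative_eq_intros d0[unfolded s] d1[unfolded s])
      have "A2 x = - \<beta> * exp (- \<beta> * x) * (s * x * y1 (z x) - \<beta> * y0 (z x))
          + (s * y1 (z x) + s * x * (y2 (z x) * (s * x)) - \<beta> * (y1 (z x) * (s * x))) * exp (- \<beta> * x)"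
      proof -
        have eq: "\<alpha>\<^sup>2 / 2 - \<beta> * \<alpha>\<^sup>2 * x = s - 2 * (\<beta> * s * x)" by (simp add: s_def)
        then show ?thesis
          unfolding A2_def s eq by (simp add: power2_eq_square algebra_simps)
      qed
      with DERIV_mult[OF e i] show ?thesis unfolding A1_def s by simp
    qed
    have c: "continuous_on UNIV (\<lambda>x. y0 (z x))" "continuous_on UNIV (\<lambda>x. y1 (z x))"
        "continuous_on UNIV (\<lambda>x. y2 (z x))"
      using DERIV_isCont[OF d0] DERIV_isCont[OF d1] isCont_o2[OF DERIV_isCont[OF dz] y2[OF z]]
      by (simp_all add: continuous_on_eq_continuous_at)
    show "continuous_on UNIV A2"
      unfolding A2_def by (intro continuous_intros c) auto
    show "A1 x = exp (- \<beta> * x) * (\<alpha>\<^sup>2 * x / 2 * y1 (z x) - \<beta> * y0 (z x))" for x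
      by (simp add: A1_def)
    show "(x\<^sup>2 + \<delta>\<^sup>2) / x * A2 x
     + (2 * l + 2 * \<beta> * x + 2 * \<beta> * \<delta>\<^sup>2 / x - \<delta>\<^sup>2 / x\<^sup>2) * A1 x
     + (2 * l * \<beta> - (\<alpha>\<^sup>2 - \<beta>\<^sup>2) * x + \<beta>\<^sup>2 * \<delta>\<^sup>2 / x - \<beta> * \<delta>\<^sup>2 / x\<^sup>2) * A x = 0"
      if x: "x \<noteq> 0" for x
    proof -
      let ?E = "exp (- \<beta> * x)" and ?y1 = "y1 (z x)" and ?y2 = "y2 (z x)"
      have o: "y0 (z x) = \<alpha>\<^sup>2 * (\<delta>\<^sup>2 + x\<^sup>2) / 4 * ?y2 + (l + 1/2) * ?y1"
        using ode[OF z, of x] by (simp add: z_def)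
      show ?thesis
        unfolding A1_def A2_def A
        by (rule stein_operator_annihilates_profile[OF x o])
    qed
  qed
qed

section \<open>Variation of constants\<close>

text \<open>
The relation \<open>A * p = B * q\<close> cancels the inhomogeneity from the first derivative of \<open>f\<close>, so \<open>f\<close> is continuously differentiable
although \<open>P\<close> and \<open>S\<close> are only differentiable almost everywhere. Repeating the computation for \<open>G\<close> exhibits it as a
primitive, that is, as a locally absolutely continuous function.
\<close>

lemma variation_of_constants:
  fixes A A1 A2 B B1 B2 p q :: "real \<Rightarrow> real" and c :: real
  defines "P \<equiv> \<lambda>x. LBINT t=ereal 0..ereal x. p t"
    and "S \<equiv> \<lambda>x. c + (LBINT t=ereal 0..ereal x. q t)"
  defines "f \<equiv> \<lambda>x. B x * S x - A x * P x"
    and "G \<equiv> \<lambda>x. B1 x * S x - A1 x * P x"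
    and "k \<equiv> \<lambda>x. B2 x * S x - A2 x * P x + (B1 x * q x - A1 x * p x)"
  assumes p: "locally_integrable p" and q: "locally_integrable q"
    and A: "\<And>x. (A has_real_derivative A1 x) (at x)" "\<And>x. (A1 has_real_derivative A2 x) (at x)" "continuous_on UNIV A2"
    and B: "\<And>x. (B has_real_derivative B1 x) (at x)" "\<And>x. (B1 has_real_derivative B2 x) (at x)" "continuous_on UNIV B2"
    and pq: "\<And>x. A x * p x = B x * q x"
  shows "\<And>x. (f has_real_derivative G x) (at x)"
    and "\<And>x. G x = G 0 + (LBINT t=ereal 0..ereal x. k t)"
    and "locally_integrable k"
proof -
  have cA: "continuous_on UNIV A" "continuous_on UNIV A1" "continuous_on UNIV B" "continuous_on UNIV B1"
    using A(1,2) B(1,2) by (blast intro: DERIV_isCont continuous_at_imp_continuous_on)+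
  have cP: "continuous_on UNIV P" "continuous_on UNIV S"
    unfolding P_def S_def using primitive_continuous[OF p] primitive_continuous[OF q]
    by (auto intro!: continuous_intros continuous_at_imp_continuous_on)
  have prodP: "u x * P x = (LBINT t=ereal 0..ereal x. u t * p t + u' t * P t)"
    if "\<And>x. (u has_real_derivative u' x) (at x)" "continuous_on UNIV u'" for u u' x
    using product_primitive[OF p that, of x 0] by (simp add: P_def)
  have prodS: "u x * S x = u 0 * c + (LBINT t=ereal 0..ereal x. u t * q t + u' t * S t)"
    if "\<And>x. (u has_real_derivative u' x) (at x)" "continuous_on UNIV u'" for u u' x
    using product_primitive[OF q that, of x c] by (simp add: S_def)
  have diff: "(LBINT t=ereal 0..ereal x. g t) - (LBINT t=ereal 0..ereal x. g' t)
     = (LBINT t=ereal 0..ereal x. g t - g' t)" if "locally_integrable g" "locally_integrable g'" for g g' x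
    using that by (intro interval_lebesgue_integral_diff(2)[symmetric] locally_integrable_interval)
  have i: "locally_integrable (\<lambda>t. u t * q t + u' t * S t)" "locally_integrable (\<lambda>t. u t * p t + u' t * P t)"
    if "continuous_on UNIV u" "continuous_on UNIV u'" for u u'
    by (intro locally_integrable_add locally_integrable_mult_continuous[OF that(1)] p q
          locally_integrable_continuous continuous_on_mult that(2) cP)+
  have cG: "continuous_on UNIV G"
    unfolding G_def by (intro continuous_intros cA cP)
  have f: "f x = B 0 * c + (LBINT t=ereal 0..ereal x. G t)" for x
    unfolding f_def prodP[OF A(1) cA(2)] prodS[OF B(1) cA(4)] add_diff_eq[symmetric]
    unfolding diff[OF i(1)[OF cA(3,4)] i(2)[OF cA(1,2)]] by (simp add: G_def pq)
  show "(f has_real_derivative G x) (at x)" for x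
    unfolding f[abs_def] using primitive_has_derivative_isCont[OF locally_integrable_continuous[OF cG], of x 0] cG
    by (auto intro!: derivative_eq_intros simp: continuous_on_eq_continuous_at)
  have keq: "(B1 t * q t + B2 t * S t) - (A1 t * p t + A2 t * P t) = k t" for t
    by (simp add: k_def)
  have "G x = B1 0 * c + (LBINT t=ereal 0..ereal x. k t)" for x
    unfolding G_def prodP[OF A(2,3)] prodS[OF B(2,3)] add_diff_eq[symmetric]
    unfolding diff[OF i(1)[OF cA(4) B(3)] i(2)[OF cA(2) A(3)]] keq ..
  then show "G x = G 0 + (LBINT t=ereal 0..ereal x. k t)" for x
    by simp
  have "locally_integrable (\<lambda>t. (B1 t * q t + B2 t * S t) + -1 * (A1 t * p t + A2 t * P t))"
    by (intro locally_integrable_add locally_integrable_mult_continuous[of "\<lambda>_. -1"] i cA A B continuous_intros)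
  then show "locally_integrable k"
    by (simp add: keq[symmetric, abs_def] k_def algebra_simps)
qed

text \<open>
The derivative \<open>G\<close> of \<open>f\<close> is a primitive of \<open>k\<close>, so \<open>f''\<close> exists and equals \<open>k\<close> almost everywhere, and also
at every continuity point of \<open>h\<close>. Inserting \<open>k\<close> into the operator, the multiples of \<open>P\<close> and \<open>S\<close> drop out by the
homogeneous equations, and the Wronskian condition leaves exactly the right-hand side.
\<close>

lemma solves_gh_stein_equationI:
  fixes A A1 A2 B B1 B2 p q h :: "real \<Rightarrow> real" and c :: real
  assumes p: "locally_integrable p" and q: "locally_integrable q"
    and A: "\<And>x. (A has_real_derivative A1 x) (at x)" "\<And>x. (A1 has_real_derivative A2 x) (at x)" "continuous_on UNIV A2"
    and B: "\<And>x. (B has_real_derivative B1 x) (at x)" "\<And>x. (B1 has_real_derivative B2 x) (at x)" "continuous_on UNIV B2"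
    and pq: "\<And>x. A x * p x = B x * q x"
    and odeA: "\<And>x. x \<noteq> 0 \<Longrightarrow> (x\<^sup>2 + \<delta>\<^sup>2) / x * A2 x
     + (2 * l + 2 * \<beta> * x + 2 * \<beta> * \<delta>\<^sup>2 / x - \<delta>\<^sup>2 / x\<^sup>2) * A1 x
     + (2 * l * \<beta> - (\<alpha>\<^sup>2 - \<beta>\<^sup>2) * x + \<beta>\<^sup>2 * \<delta>\<^sup>2 / x - \<beta> * \<delta>\<^sup>2 / x\<^sup>2) * A x = 0"
    and odeB: "\<And>x. x \<noteq> 0 \<Longrightarrow> (x\<^sup>2 + \<delta>\<^sup>2) / x * B2 x
     + (2 * l + 2 * \<beta> * x + 2 * \<beta> * \<delta>\<^sup>2 / x - \<delta>\<^sup>2 / x\<^sup>2) * B1 x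
     + (2 * l * \<beta> - (\<alpha>\<^sup>2 - \<beta>\<^sup>2) * x + \<beta>\<^sup>2 * \<delta>\<^sup>2 / x - \<beta> * \<delta>\<^sup>2 / x\<^sup>2) * B x = 0"
    and \<delta>: "\<delta> > 0"
    and W: "\<And>x. B1 x * q x - A1 x * p x = x / (x\<^sup>2 + \<delta>\<^sup>2) * (h x - gh_expectation l \<alpha> \<beta> \<delta> h)"
    and f: "f = (\<lambda>x. B x * (c + (LBINT t=ereal 0..ereal x. q t)) - A x * (LBINT t=ereal 0..ereal x. p t))"
  shows "solves_gh_stein_equation l \<alpha> \<beta> \<delta> h f"
proof -
  let ?P = "\<lambda>x. LBINT t=ereal 0..ereal x. p t"
  let ?S = "\<lambda>x. c + (LBINT t=ereal 0..ereal x. q t)"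
  let ?h = "\<lambda>x. h x - gh_expectation l \<alpha> \<beta> \<delta> h"
  define G where "G = (\<lambda>x. B1 x * ?S x - A1 x * ?P x)"
  define k where "k = (\<lambda>x. B2 x * ?S x - A2 x * ?P x + (B1 x * q x - A1 x * p x))"
  have vc: "(f has_real_derivative G x) (at x)" for x
    unfolding f G_def by (rule variation_of_constants(1)[OF p q A B pq])
  have Gk0: "G x = G 0 + (LBINT t=ereal 0..ereal x. k t)" for x
    unfolding G_def k_def by (rule variation_of_constants(2)[OF p q A B pq])
  have kint: "locally_integrable k"
    unfolding k_def by (rule variation_of_constants(3)[OF p q A B pq])
  have fG: "deriv f = G"
    using vc by (auto intro: DERIV_imp_deriv)
  have k_eq: "k x = B2 x * ?S x - A2 x * ?P x + x / (x\<^sup>2 + \<delta>\<^sup>2) * ?h x" for x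
    by (simp only: k_def W)
  have Gk: "(G has_real_derivative k x) (at x)"
    if "((\<lambda>x. LBINT t=ereal 0..ereal x. k t) has_real_derivative k x) (at x)" for x
  proof -
    have "((\<lambda>x. G 0 + (LBINT t=ereal 0..ereal x. k t)) has_real_derivative k x) (at x)"
      using that by (auto intro!: derivative_eq_intros)
    then show ?thesis by (simp only: Gk0[symmetric])
  qed
  have stein: "G differentiable (at x) \<and> gh_stein_operator l \<alpha> \<beta> \<delta> f x = ?h x"
    if x: "x \<noteq> 0" and d: "(G has_real_derivative k x) (at x)" for x
  proof
    show "G differentiable (at x)" using d by (auto simp: real_differentiable_def)
    have dd: "deriv G x = k x" using d by (rule DERIV_imp_deriv)
    have r: "(x\<^sup>2 + \<delta>\<^sup>2) / x * (x / (x\<^sup>2 + \<delta>\<^sup>2) * ?h x) = ?h x"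
    proof -
      have "x\<^sup>2 + \<delta>\<^sup>2 > 0" using \<delta> by (intro add_nonneg_pos) auto
      then show ?thesis using x by simp
    qed
    let ?a = "(x\<^sup>2 + \<delta>\<^sup>2) / x" and ?b = "2 * l + 2 * \<beta> * x + 2 * \<beta> * \<delta>\<^sup>2 / x - \<delta>\<^sup>2 / x\<^sup>2"
      and ?c = "2 * l * \<beta> - (\<alpha>\<^sup>2 - \<beta>\<^sup>2) * x + \<beta>\<^sup>2 * \<delta>\<^sup>2 / x - \<beta> * \<delta>\<^sup>2 / x\<^sup>2"
    have "gh_stein_operator l \<alpha> \<beta> \<delta> f x = ?a * k x + ?b * G x + ?c * f x"
      unfolding gh_stein_operator_def fG dd ..
    also have "\<dots> = (?a * B2 x + ?b * B1 x + ?c * B x) * ?S x - (?a * A2 x + ?b * A1 x + ?c * A x) * ?P x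
        + ?a * (x / (x\<^sup>2 + \<delta>\<^sup>2) * ?h x)"
      unfolding k_eq G_def f by (simp only: algebra_simps)
    also have "\<dots> = ?h x"
      unfolding odeA[OF x] odeB[OF x] r by simp
    finally show "gh_stein_operator l \<alpha> \<beta> \<delta> f x = ?h x" .
  qed
  have AE_k: "AE x in lborel. (G has_real_derivative k x) (at x)"
    using primitive_has_derivative_AE[OF kint, of 0] by eventually_elim (rule Gk)
  have AE_0: "AE x in lborel. x \<noteq> (0::real)"
    by (rule AE_lborel_singleton)
  show ?thesis
    unfolding solves_gh_stein_equation_def fG
  proof (intro conjI allI impI)
    show "f differentiable at x" for x
      using vc by (auto simp: real_differentiable_def)
  next
    fix a b :: real assume ab: "a \<le> b"
    obtain N where N: "negligible N" "\<And>x. x \<notin> N \<Longrightarrow> deriv G x = k x"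
    proof -
      from AE_k have "AE x in lebesgue. (G has_real_derivative k x) (at x)"
        by (rule AE_completion)
      then obtain N where "N \<in> null_sets lebesgue" "{x. \<not> (G has_real_derivative k x) (at x)} \<subseteq> N"
        by (auto simp: eventually_ae_filter)
      then show ?thesis
        using that[of N] by (auto simp: negligible_iff_null_sets intro: DERIV_imp_deriv)
    qed
    have kb: "set_integrable lborel {a..b} k"
      using kint by (simp add: locally_integrable_def)
    have k_abs: "k absolutely_integrable_on {a..b}"
      using kb unfolding set_integrable_def by (intro integrable_completion[THEN iffD2]) auto
    then show "deriv G absolutely_integrable_on {a..b}"
      by (rule absolutely_integrable_spike[OF _ N(1)]) (use N(2) in auto)
    have "G b - G a = (LBINT t=ereal a..ereal b. k t)"
      using Gk0[of a] Gk0[of b] locally_integrable_interval_sum[OF kint, of 0 a b] by simp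
    also have "\<dots> = integral {a..b} k"
      by (rule interval_integral_eq_integral[OF ab kb])
    finally have "(k has_integral (G b - G a)) {a..b}"
      using locally_integrable_integrable_on[OF kint, of a b] by (simp add: has_integral_iff)
    then show "(deriv G has_integral (G b - G a)) {a..b}"
      by (rule has_integral_spike[OF N(1), rotated]) (use N(2) in auto)
  next
    show "AE x in lborel. G differentiable at x \<and> gh_stein_operator l \<alpha> \<beta> \<delta> f x = ?h x"
      using AE_k AE_0 by eventually_elim (rule stein)
  next
    fix x assume x: "x \<noteq> 0 \<and> isCont h x"
    have "isCont ?P x" "isCont (\<lambda>x. LBINT t=ereal 0..ereal x. q t) x"
      by (rule primitive_continuous[OF p], rule primitive_continuous[OF q])
    moreover have "isCont A2 x" "isCont B2 x"
      using A(3) B(3) by (auto simp: continuous_on_eq_continuous_at)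
    moreover have "x\<^sup>2 + \<delta>\<^sup>2 \<noteq> 0"
      using \<delta> add_nonneg_pos[of "x\<^sup>2" "\<delta>\<^sup>2"] by auto
    ultimately have "isCont k x"
      unfolding k_eq[abs_def] using x by (intro continuous_intros) auto
    then have "(G has_real_derivative k x) (at x)"
      by (intro Gk primitive_has_derivative_isCont kint)
    then show "G differentiable at x" "gh_stein_operator l \<alpha> \<beta> \<delta> f x = ?h x"
      using stein x by auto
  qed
qed

section \<open>The solution of the Stein equation\<close>

theorem lemma3p4:
  fixes l \<alpha> \<beta> \<delta> \<nu> :: real and h h' f :: "real \<Rightarrow> real"
  assumes "\<delta> > 0" and "\<alpha> > \<bar>\<beta>\<bar>" and "\<nu> = l - 1 / 2"
    and "h \<in> borel_measurable borel"
    and "integrable (gh_distribution l \<alpha> \<beta> \<delta>) h"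
    and "h' = (\<lambda>x. h x - gh_expectation l \<alpha> \<beta> \<delta> h)"
    and "f = (\<lambda>x.
      - (exp (- \<beta> * x) * bessel_K \<nu> (\<alpha> * sqrt (\<delta>\<^sup>2 + x\<^sup>2)) / (\<delta>\<^sup>2 + x\<^sup>2) powr (\<nu> / 2)) *
        (LBINT t=0..ereal x.
           exp (\<beta> * t) * (\<delta>\<^sup>2 + t\<^sup>2) powr (\<nu> / 2) * bessel_I \<nu> (\<alpha> * sqrt (t\<^sup>2 + \<delta>\<^sup>2)) * h' t)
      - (exp (- \<beta> * x) * bessel_I \<nu> (\<alpha> * sqrt (\<delta>\<^sup>2 + x\<^sup>2)) / (\<delta>\<^sup>2 + x\<^sup>2) powr (\<nu> / 2)) *
        (LBINT t=ereal x..\<infinity>.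
           exp (\<beta> * t) * (\<delta>\<^sup>2 + t\<^sup>2) powr (\<nu> / 2) * bessel_K \<nu> (\<alpha> * sqrt (t\<^sup>2 + \<delta>\<^sup>2)) * h' t))"
  shows
    "(\<forall>x. interval_lebesgue_integrable lborel 0 (ereal x)
           (\<lambda>t. exp (\<beta> * t) * (\<delta>\<^sup>2 + t\<^sup>2) powr (\<nu> / 2) * bessel_I \<nu> (\<alpha> * sqrt (t\<^sup>2 + \<delta>\<^sup>2)) * h' t) \<and>
         interval_lebesgue_integrable lborel (ereal x) \<infinity>
           (\<lambda>t. exp (\<beta> * t) * (\<delta>\<^sup>2 + t\<^sup>2) powr (\<nu> / 2) * bessel_K \<nu> (\<alpha> * sqrt (t\<^sup>2 + \<delta>\<^sup>2)) * h' t) \<and>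
         interval_lebesgue_integrable lborel (- \<infinity>) (ereal x)
           (\<lambda>t. exp (\<beta> * t) * (\<delta>\<^sup>2 + t\<^sup>2) powr (\<nu> / 2) * bessel_K \<nu> (\<alpha> * sqrt (t\<^sup>2 + \<delta>\<^sup>2)) * h' t))
     \<and> (\<forall>x. f x =
      - (exp (- \<beta> * x) * bessel_K \<nu> (\<alpha> * sqrt (\<delta>\<^sup>2 + x\<^sup>2)) / (\<delta>\<^sup>2 + x\<^sup>2) powr (\<nu> / 2)) *
        (LBINT t=0..ereal x.
           exp (\<beta> * t) * (\<delta>\<^sup>2 + t\<^sup>2) powr (\<nu> / 2) * bessel_I \<nu> (\<alpha> * sqrt (t\<^sup>2 + \<delta>\<^sup>2)) * h' t)
      + (exp (- \<beta> * x) * bessel_I \<nu> (\<alpha> * sqrt (\<delta>\<^sup>2 + x\<^sup>2)) / (\<delta>\<^sup>2 + x\<^sup>2) powr (\<nu> / 2)) *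
        (LBINT t=- \<infinity>..ereal x.
           exp (\<beta> * t) * (\<delta>\<^sup>2 + t\<^sup>2) powr (\<nu> / 2) * bessel_K \<nu> (\<alpha> * sqrt (t\<^sup>2 + \<delta>\<^sup>2)) * h' t))
     \<and> solves_gh_stein_equation l \<alpha> \<beta> \<delta> h f"
proof -
  note \<delta> = assms(1) and \<alpha> = assms(2) and \<nu> = assms(3) and h'_def = assms(6)
  have a0: "\<alpha> > 0" using \<alpha> by linarith
  define R where "R = (\<lambda>x. \<delta>\<^sup>2 + x\<^sup>2)"
  define z where "z = (\<lambda>x. \<alpha>\<^sup>2 * R x / 4)"
  define c where "c = (\<alpha> / 2) powr \<nu>"
  define r where "r = (\<lambda>x. R x powr (\<nu> / 2))"
  define K where "K = (\<lambda>x. bessel_K \<nu> (\<alpha> * sqrt (R x)))"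
  define I where "I = (\<lambda>x. bessel_I \<nu> (\<alpha> * sqrt (R x)))"
  define A where "A = (\<lambda>x. exp (- \<beta> * x) * K x / r x)"
  define B where "B = (\<lambda>x. exp (- \<beta> * x) * I x / r x)"
  define a where "a = (\<lambda>x. exp (\<beta> * x) * r x * K x)"
  define b where "b = (\<lambda>x. exp (\<beta> * x) * r x * I x)"
  define p where "p = (\<lambda>x. b x * h' x)"
  define q where "q = (\<lambda>x. a x * h' x)"
  have R: "R x > 0" for x using \<delta> by (auto simp: R_def intro: add_pos_nonneg)
  have z: "z x > 0" for x using R[of x] a0 by (simp add: z_def)
  have c: "c > 0" using a0 by (simp add: c_def)
  have r: "r x > 0" for x using R[of x] by (simp add: r_def)
  have K: "K x > 0" for x using R[of x] a0 by (auto simp: K_def intro!: bessel_K_pos)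
  have cR: "continuous_on UNIV R" unfolding R_def by (intro continuous_intros)
  have cr: "continuous_on UNIV r"
    unfolding r_def using R by (intro continuous_intros cR) (auto simp: less_imp_neq[symmetric])
  \<comment> \<open>the derivatives of order k, in z, of the two fundamental solutions\<close>
  define yK where "yK = (\<lambda>k t. (-1) ^ k * (c / 2) * gig_integral (- \<nu> - real k) 1 t)"
  define yI where "yI = (\<lambda>k t. c * bessel_series (\<nu> + real k) t)"
  have KyK: "K x / r x = yK 0 (z x)" and IyI: "I x / r x = yI 0 (z x)" for x
    using powr_bessel_K_eq_gig(2,3)[OF a0 R[of x], of \<nu>]
    by (simp_all add: K_def I_def r_def yK_def yI_def c_def z_def)
  have dK: "(yK k has_real_derivative yK (Suc k) t) (at t)" if "t > 0" for k t
    using gig_integral_has_derivative[of 1 t "- \<nu> - real k"] that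
    unfolding yK_def[abs_def] by (auto intro!: derivative_eq_intros simp: algebra_simps)
  have dI: "(yI k has_real_derivative yI (Suc k) t) (at t)" for k t
    using bessel_series_has_derivative[of "\<nu> + real k" t]
    unfolding yI_def[abs_def] by (auto intro!: derivative_eq_intros simp: algebra_simps)
  have oK: "t * yK 2 t + (l + 1/2) * yK 1 t = yK 0 t" if "t > 0" for t
    using gig_recurrence_order[OF that, of \<nu>] by (simp add: yK_def \<nu> algebra_simps)
  have oI: "t * yI 2 t + (l + 1/2) * yI 1 t = yI 0 t" for t
    using bessel_series_recurrence[of \<nu> t] by (simp add: yI_def \<nu> algebra_simps)
  have A_eq: "A = (\<lambda>x. exp (- \<beta> * x) * yK 0 (z x))"
    using KyK by (auto simp: A_def simp flip: times_divide_eq_right)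
  have B_eq: "B = (\<lambda>x. exp (- \<beta> * x) * yI 0 (z x))"
    using IyI by (auto simp: B_def simp flip: times_divide_eq_right)
  have z_eq: "z = (\<lambda>x. \<alpha>\<^sup>2 * (\<delta>\<^sup>2 + x\<^sup>2) / 4)"
    by (simp add: z_def R_def)
  obtain A1 A2 where A: "\<And>x. (A has_real_derivative A1 x) (at x)" "\<And>x. (A1 has_real_derivative A2 x) (at x)"
      "continuous_on UNIV A2"
    and A1: "\<And>x. A1 x = exp (- \<beta> * x) * (\<alpha>\<^sup>2 * x / 2 * yK 1 (z x) - \<beta> * yK 0 (z x))"
    and odeA: "\<And>x. x \<noteq> 0 \<Longrightarrow> (x\<^sup>2 + \<delta>\<^sup>2) / x * A2 x
     + (2 * l + 2 * \<beta> * x + 2 * \<beta> * \<delta>\<^sup>2 / x - \<delta>\<^sup>2 / x\<^sup>2) * A1 x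
     + (2 * l * \<beta> - (\<alpha>\<^sup>2 - \<beta>\<^sup>2) * x + \<beta>\<^sup>2 * \<delta>\<^sup>2 / x - \<beta> * \<delta>\<^sup>2 / x\<^sup>2) * A x = 0"
  proof (rule bessel_profile_derivatives[OF z_eq A_eq a0 \<delta>])
    fix t :: real assume t: "t > 0"
    show "(yK 0 has_real_derivative yK 1 t) (at t)" "(yK 1 has_real_derivative yK 2 t) (at t)"
      using dK[OF t, of 0] dK[OF t, of 1] by (simp_all add: numeral_2_eq_2)
    show "isCont (yK 2) t" using dK[OF t, of 2] by (rule DERIV_isCont)
    show "t * yK 2 t + (l + 1/2) * yK 1 t = yK 0 t" by (rule oK[OF t])
  qed (rule that)
  obtain B1 B2 where B: "\<And>x. (B has_real_derivative B1 x) (at x)" "\<And>x. (B1 has_real_derivative B2 x) (at x)"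
      "continuous_on UNIV B2"
    and B1: "\<And>x. B1 x = exp (- \<beta> * x) * (\<alpha>\<^sup>2 * x / 2 * yI 1 (z x) - \<beta> * yI 0 (z x))"
    and odeB: "\<And>x. x \<noteq> 0 \<Longrightarrow> (x\<^sup>2 + \<delta>\<^sup>2) / x * B2 x
     + (2 * l + 2 * \<beta> * x + 2 * \<beta> * \<delta>\<^sup>2 / x - \<delta>\<^sup>2 / x\<^sup>2) * B1 x
     + (2 * l * \<beta> - (\<alpha>\<^sup>2 - \<beta>\<^sup>2) * x + \<beta>\<^sup>2 * \<delta>\<^sup>2 / x - \<beta> * \<delta>\<^sup>2 / x\<^sup>2) * B x = 0"
  proof (rule bessel_profile_derivatives[OF z_eq B_eq a0 \<delta>])
    fix t :: real
    show "(yI 0 has_real_derivative yI 1 t) (at t)" "(yI 1 has_real_derivative yI 2 t) (at t)"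
      using dI[of 0 t] dI[of 1 t] by (simp_all add: numeral_2_eq_2)
    show "isCont (yI 2) t" using dI[of 2 t] by (rule DERIV_isCont)
    show "t * yI 2 t + (l + 1/2) * yI 1 t = yI 0 t" by (rule oI)
  qed (rule that)
  \<comment> \<open>the factor between the integrands and the fundamental solutions; it is what makes A p = B q\<close>
  define \<rho> where "\<rho> = (\<lambda>x. exp (2 * \<beta> * x) * (r x * r x))"
  have e2: "exp (\<beta> * x) = exp (2 * \<beta> * x) * exp (- \<beta> * x)" for x
    by (simp flip: exp_add)
  have a_eq: "a x = \<rho> x * A x" and b_eq: "b x = \<rho> x * B x" for x
    using r[of x] by (simp_all add: a_def b_def A_def B_def \<rho>_def e2)
  have cAB: "continuous_on UNIV A" "continuous_on UNIV B"
    using A(1) B(1) by (blast intro: DERIV_isCont continuous_at_imp_continuous_on)+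
  have cab: "continuous_on UNIV a" "continuous_on UNIV b"
    unfolding a_eq[abs_def] b_eq[abs_def] \<rho>_def by (intro continuous_intros cr cAB)+
  have a_pos: "a x > 0" for x using r[of x] K[of x] by (simp add: a_def)
  have a_weight: "a = (\<lambda>x. exp (\<beta> * x) * (\<delta>\<^sup>2 + x\<^sup>2) powr ((l - 1/2) / 2) * bessel_K (l - 1/2) (\<alpha> * sqrt (\<delta>\<^sup>2 + x\<^sup>2)))"
    by (simp add: a_def r_def K_def R_def \<nu>)
  note centred = gh_weight_centred[OF a_weight \<delta> \<alpha> assms(4,5) cab(1) a_pos]
  have q_int: "integrable lborel q" and q0: "integral\<^sup>L lborel q = 0"
    using centred unfolding q_def h'_def by auto
  have q: "locally_integrable q"
    unfolding locally_integrable_def set_integrable_def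
    using integrable_mult_indicator[OF _ q_int] by auto
  have p: "locally_integrable p"
  proof -
    \<comment> \<open>b times h' need not be integrable on the whole line, but a is bounded below on compact intervals\<close>
    have "p = (\<lambda>x. (b x / a x) * q x)"
      using a_pos by (auto simp: p_def q_def less_imp_neq[symmetric])
    moreover have "continuous_on UNIV (\<lambda>x. b x / a x)"
      using a_pos by (intro continuous_intros cab) (auto simp: less_imp_neq[symmetric])
    ultimately show ?thesis using locally_integrable_mult_continuous q by metis
  qed
  have q_iv: "interval_lebesgue_integrable lborel u v q" for u v
    unfolding interval_lebesgue_integrable_def set_integrable_def
    using integrable_mult_indicator[OF _ q_int] by auto
  have pK: "(\<lambda>t. exp (\<beta> * t) * (\<delta>\<^sup>2 + t\<^sup>2) powr (\<nu> / 2) * bessel_K \<nu> (\<alpha> * sqrt (t\<^sup>2 + \<delta>\<^sup>2)) * h' t) = q"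
    and pI: "(\<lambda>t. exp (\<beta> * t) * (\<delta>\<^sup>2 + t\<^sup>2) powr (\<nu> / 2) * bessel_I \<nu> (\<alpha> * sqrt (t\<^sup>2 + \<delta>\<^sup>2)) * h' t) = p"
    by (simp_all add: p_def q_def a_def b_def r_def K_def I_def R_def add.commute)
  have Ax: "exp (- \<beta> * x) * bessel_K \<nu> (\<alpha> * sqrt (\<delta>\<^sup>2 + x\<^sup>2)) / (\<delta>\<^sup>2 + x\<^sup>2) powr (\<nu> / 2) = A x"
    and Bx: "exp (- \<beta> * x) * bessel_I \<nu> (\<alpha> * sqrt (\<delta>\<^sup>2 + x\<^sup>2)) / (\<delta>\<^sup>2 + x\<^sup>2) powr (\<nu> / 2) = B x" for x
    by (simp_all add: A_def B_def r_def K_def I_def R_def)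
  have f: "f = (\<lambda>x. - A x * (LBINT t=0..ereal x. p t) - B x * (LBINT t=ereal x..\<infinity>. q t))"
    unfolding assms(7) pK pI Ax Bx ..
  define c0 where "c0 = (LBINT t=ereal 0..\<infinity>. q t)"
  have tail: "(LBINT t=ereal x..\<infinity>. q t) = c0 - (LBINT t=ereal 0..ereal x. q t)" for x
    using interval_integral_sum[OF q_iv, of "ereal 0" "ereal x" \<infinity>] by (simp add: c0_def)
  \<comment> \<open>the two formulas for f differ by the integral of q over the line, which is zero\<close>
  have tail': "(LBINT t=ereal x..\<infinity>. q t) = - (LBINT t=-\<infinity>..ereal x. q t)" for x
  proof -
    have "(LBINT t=-\<infinity>..\<infinity>. q t) = 0"
      using q0 by (simp add: interval_lebesgue_integral_def set_lebesgue_integral_def einterval_def)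
    then show ?thesis
      using interval_integral_sum[OF q_iv, of "-\<infinity>" "ereal x" \<infinity>] by simp
  qed
  have "solves_gh_stein_equation l \<alpha> \<beta> \<delta> h f"
  proof (rule solves_gh_stein_equationI[OF p q A B _ odeA odeB \<delta>])
    show "A x * p x = B x * q x" for x
      by (simp add: p_def q_def a_eq b_eq)
    show "f = (\<lambda>x. B x * (- c0 + (LBINT t=ereal 0..ereal x. q t)) - A x * (LBINT t=ereal 0..ereal x. p t))"
      unfolding f tail by (simp add: zero_ereal_def algebra_simps)
    show "B1 x * q x - A1 x * p x = x / (x\<^sup>2 + \<delta>\<^sup>2) * (h x - gh_expectation l \<alpha> \<beta> \<delta> h)" for x
    proof -
      let ?E0 = "bessel_series \<nu> (z x)" and ?E1 = "bessel_series (\<nu> + 1) (z x)"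
        and ?M0 = "gig_integral (- \<nu>) 1 (z x)" and ?M1 = "gig_integral (- \<nu> - 1) 1 (z x)"
      let ?e = "exp (- \<beta> * x)"
      have ee: "exp (2 * \<beta> * x) * (?e * ?e) = 1" by (simp flip: exp_add)
      have AB: "A x = ?e * yK 0 (z x)" "B x = ?e * yI 0 (z x)"
        by (simp_all add: A_eq B_eq)
      have "B1 x * a x - A1 x * b x = \<rho> x * (B1 x * A x - A1 x * B x)"
        by (simp add: a_eq b_eq algebra_simps)
      also have "B1 x * A x - A1 x * B x = (?e * ?e) * (\<alpha>\<^sup>2 * x / 2 * (yI 1 (z x) * yK 0 (z x) - yK 1 (z x) * yI 0 (z x)))"
        unfolding A1 B1 AB by (simp only: algebra_simps)
      \<comment> \<open>the Wronskian in the variable z, which wronskian_form_eq_1 evaluates\<close>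
      also have "yI 1 (z x) * yK 0 (z x) - yK 1 (z x) * yI 0 (z x) = c * c / 2 * (?E0 * ?M1 + ?E1 * ?M0)"
        by (simp add: yI_def yK_def algebra_simps)
      also have "\<rho> x * ((?e * ?e) * (\<alpha>\<^sup>2 * x / 2 * (c * c / 2 * (?E0 * ?M1 + ?E1 * ?M0))))
         = (exp (2 * \<beta> * x) * (?e * ?e)) * (\<alpha>\<^sup>2 * x / 4 * ((c * r x * (c * r x)) * (?E0 * ?M1 + ?E1 * ?M0)))"
        by (simp add: \<rho>_def mult_ac)
      also have "c * r x * (c * r x) = z x powr \<nu>"
      proof -
        have "c * r x = z x powr (\<nu> / 2)"
          unfolding c_def r_def z_def by (rule scaled_powr_half[OF a0 R, symmetric])
        then show ?thesis by (simp flip: powr_add)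
      qed
      also have "z x powr \<nu> * (?E0 * ?M1 + ?E1 * ?M0) = 1 / z x"
        using wronskian_form_eq_1[OF z[of x], of \<nu>] z[of x]
        by (simp add: wronskian_form_def powr_add field_simps)
      also have "exp (2 * \<beta> * x) * (?e * ?e) * (\<alpha>\<^sup>2 * x / 4 * (1 / z x)) = x / R x"
        unfolding ee z_def using a0 R[of x] by simp
      finally have "B1 x * a x - A1 x * b x = x / R x" .
      then have "(B1 x * a x - A1 x * b x) * h' x = x / (x\<^sup>2 + \<delta>\<^sup>2) * h' x"
        by (simp add: R_def add.commute)
      then show ?thesis
        by (simp add: p_def q_def h'_def left_diff_distrib mult.assoc)
    qed
  qed
  moreover have "interval_lebesgue_integrable lborel 0 (ereal x) p" for x
    using locally_integrable_interval[OF p, of 0 x] by (simp add: zero_ereal_def)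
  moreover have "f x = - A x * (LBINT t=0..ereal x. p t) + B x * (LBINT t=-\<infinity>..ereal x. q t)" for x
    unfolding f tail' by simp
  ultimately show ?thesis
    unfolding pK pI Ax Bx using q_iv by blast
qed

end
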